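(* Let $K$ be a two-dimensional local field, $V=K$, $H=K^*$ acting on $K$ by multiplication, and $L=\mathcal O_K$. Consider the central extension $0\to\mathbb Z\to G_{V,L}\to K^*\to 1$ described in the context. Then for all $f,g\in K^*$, $$\psi_V(f,g)=-\nu_K(f,g).$$
   Context: $k$ is a field, $K=k((t_1))((t_2))$, $\bar K=k((t_1))$, $\mathcal O_K=\bar K[[t_2]]$. For $b\in K^*$: $\nu_2(b)$ is the $t_2$-adic valuation, $\nu_1(b)$ is the $t_1$-adic valuation of the residue of $b t_2^{-\nu_2(b)}$ modulo $t_2\mathcal O_K$; $\nu_K(f,g)=\nu_1(f)\nu_2(g)-\nu_2(f)\nu_1(g)$. Dimension theories. Let $W$ be a $k$-vector space with an (exhaustive, separated) filtration by subspaces whose successive quotients are finite-dimensional over $k$. Subspaces $U_1,U_2$ are commensurable if $\dim_k U_i/(U_1\cap U_2)<\infty$ for $i=1,2$; then $[U_1|U_2]:=\dim_k U_2/(U_1\cap U_2)-\dim_k U_1/(U_1\cap U_2)$. $\mathrm{Gr}(W)$ is the set of subspaces commensurable with some member of the filtration. $\mathrm{Dim}(W)$ is the set of maps $d:\mathrm{Gr}(W)\to\mathbb Z$ with $d(U_2)=d(U_1)+[U_1|U_2]$ for all $U_1,U_2$; $\mathbb Z$ acts by adding constants, making $\mathrm{Dim}(W)$ a $\mathbb Z$-torsor. For an exact sequence $0\to W'\xrightarrow{\alpha}W\xrightarrow{\beta}W''\to0$ with induced and quotient filtrations, there is the identification $\mathrm{Dim}(W')\odot\mathrm{Dim}(W'')\cong\mathrm{Dim}(W)$,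 $(d',d'')\mapsto(U\mapsto d'(\alpha^{-1}U)+d''(\beta U))$ ($\odot$ = tensor product of $\mathbb Z$-torsors). Commensurability in $K$. An $\mathcal O_K$-lattice is a nonzero proper $\mathcal O_K$-submodule $L$ with $L\otimes_{\mathcal O_K}K=K$. For $k$-subspaces $A,B\subset K$, $A\approx B$ iff there are $\mathcal O_K$-lattices $L\subseteq M$ with $L\subseteq A\subseteq M$ and $L\subseteq B\subseteq M$. If $C\subseteq A$, $C\approx A$, then $A/C$ is a subquotient of the finite-dimensional $\bar K$-space $M/L$ and carries the filtration induced by the $k[[t_1]]$-lattices of $M/L$, with finite-dimensional factors. For $A\approx B$ define the $\mathbb Z$-torsor $$[[A|B]]=\varinjlim_{C\subseteq A\cap B,\ C\approx A}\mathrm{Hom}_{\mathbb Z}(\mathrm{Dim}(A/C),\mathrm{Dim}(B/C)),$$ with transition for $C'\subseteq C$ given by $\phi\mapsto\phi\odot\mathrm{id}_{\mathrm{Dim}(C/C')}$ under $\mathrm{Dim}(A/C')=\mathrm{Dim}(A/C)\odot\mathrm{Dim}(C/C')$, and similarly for $B$. Composition gives $[[A|B]]\times[[B|C]]\to[[A|C]]$, written $(d,d')\mapsto d\odot d'$. An invertible $k$-linear $h$ with $hA\approx hB$ acts by $(h\circ d)(U)=d(h^{-1}U)$ on dimension theories and by conjugation $\phi\mapsto h\phi h^{-1}$ on homomorphisms, giving $h:[[A|B]]\to[[hA|hB]]$. $[[L|L]]$ contains the identity $\mathrm{id}$ and is identified with $\mathbb Z$ via $\mathrm{id}+n\mapsto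 n$. Central extension. $G_{V,L}$ is the set of pairs $(h,d)$, $h\in K^*$, $d\in[[L|hL]]$, with product $(h,d)(g,d')=(hg,\,d\odot(h\circ d'))$; its kernel over $K^*$ is $\{(1,d):d\in[[L|L]]\}\cong\mathbb Z$. For commuting $f,g$, choose lifts $\hat f,\hat g\in G_{V,L}$; $\hat f\hat g$ and $\hat g\hat f$ have the same first component $fg$, and $\psi_V(f,g)\in\mathbb Z$ is the unique integer $n$ such that the second component of $\hat f\hat g$ equals the second component of $\hat g\hat f$ shifted by $n$ in the $\mathbb Z$-torsor $[[L|fgL]]$ (it does not depend on the lifts). *)

theory Defs
  imports "HOL-Computational_Algebra.Formal_Laurent_Series" "HOL-Library.FuncSet"
begin

(* K = k((t1))((t2)) is modelled as the type 'k fls fls (outer variable t2,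
   inner variable t1); Kbar = k((t1)) is 'k fls. *)
type_synonym 'k K2 = "'k fls fls"
type_synonym 'k dimth = "'k K2 set \<Rightarrow> int"
type_synonym 'k thom = "'k dimth \<Rightarrow> 'k dimth"

definition nu2 :: "'k::field K2 \<Rightarrow> int" where
  "nu2 b = fls_subdegree b"

(* residue of b * t2^(-nu2 b) modulo t2 O_K is the leading t2-coefficient *)
definition nu1 :: "'k::field K2 \<Rightarrow> int" where
  "nu1 b = fls_subdegree (fls_nth b (fls_subdegree b))"

definition nuK :: "'k::field K2 \<Rightarrow> 'k K2 \<Rightarrow> int" where
  "nuK f g = nu1 f * nu2 g - nu2 f * nu1 g"

definition kc :: "'k::field \<Rightarrow> 'k K2" where
  "kc c = fls_const (fls_const c)"

definition kspace :: "'k::field K2 set \<Rightarrow> bool" where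
  "kspace A \<longleftrightarrow> 0 \<in> A \<and> (\<forall>x\<in>A. \<forall>y\<in>A. x + y \<in> A) \<and> (\<forall>c. \<forall>x\<in>A. kc c * x \<in> A)"

definition kspan :: "'k::field K2 set \<Rightarrow> 'k K2 set" where
  "kspan S = \<Inter>{W. kspace W \<and> S \<subseteq> W}"

definition ssum :: "'k::field K2 set \<Rightarrow> 'k K2 set \<Rightarrow> 'k K2 set" where
  "ssum X Y = {x + y |x y. x \<in> X \<and> y \<in> Y}"

definition mulset :: "'k::field K2 \<Rightarrow> 'k K2 set \<Rightarrow> 'k K2 set" where
  "mulset h A = (\<lambda>x. h * x) ` A"

definition qfin :: "'k::field K2 set \<Rightarrow> 'k K2 set \<Rightarrow> bool" where
  "qfin X Y \<longleftrightarrow> (\<exists>S. finite S \<and> S \<subseteq> X \<and> X \<subseteq> ssum Y (kspan S))"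

definition qdim :: "'k::field K2 set \<Rightarrow> 'k K2 set \<Rightarrow> nat" where
  "qdim X Y = (LEAST n. \<exists>S. finite S \<and> S \<subseteq> X \<and> card S = n \<and> X \<subseteq> ssum Y (kspan S))"

definition commens :: "'k::field K2 set \<Rightarrow> 'k K2 set \<Rightarrow> bool" where
  "commens U1 U2 \<longleftrightarrow> qfin U1 (U1 \<inter> U2) \<and> qfin U2 (U1 \<inter> U2)"

definition relidx :: "'k::field K2 set \<Rightarrow> 'k K2 set \<Rightarrow> int" where
  "relidx U1 U2 = int (qdim U2 (U1 \<inter> U2)) - int (qdim U1 (U1 \<inter> U2))"

definition OK :: "'k::field K2 set" where
  "OK = {x. \<forall>n<0. fls_nth x n = 0}"

definition kt1 :: "'k::field fls set" where
  "kt1 = {a. \<forall>n<0. fls_nth a n = 0}"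

definition OK_lattice :: "'k::field K2 set \<Rightarrow> bool" where
  "OK_lattice L \<longleftrightarrow> L \<noteq> {0} \<and> L \<noteq> UNIV \<and> 0 \<in> L \<and> (\<forall>x\<in>L. \<forall>y\<in>L. x + y \<in> L)
     \<and> (\<forall>a\<in>OK. \<forall>x\<in>L. a * x \<in> L)
     \<and> (\<forall>x. \<exists>a l. l \<in> L \<and> x = a * l)"

definition approx :: "'k::field K2 set \<Rightarrow> 'k K2 set \<Rightarrow> bool" where
  "approx A B \<longleftrightarrow> kspace A \<and> kspace B \<and> (\<exists>L M. OK_lattice L \<and> OK_lattice M \<and> L \<subseteq> M \<and>
      L \<subseteq> A \<and> A \<subseteq> M \<and> L \<subseteq> B \<and> B \<subseteq> M)"

definition t1module :: "'k::field K2 set \<Rightarrow> bool" where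
  "t1module W \<longleftrightarrow> 0 \<in> W \<and> (\<forall>x\<in>W. \<forall>y\<in>W. x + y \<in> W) \<and> (\<forall>a\<in>kt1. \<forall>x\<in>W. fls_const a * x \<in> W)"

definition t1span :: "'k::field K2 set \<Rightarrow> 'k K2 set" where
  "t1span S = \<Inter>{W. t1module W \<and> S \<subseteq> W}"

(* Lam/L is a k[[t1]]-lattice of the finite-dimensional Kbar-space M/L
   (represented by its preimage Lam, L \<subseteq> Lam \<subseteq> M):
   a finitely generated k[[t1]]-submodule whose Kbar-span is M/L *)
definition t1lattice :: "'k::field K2 set \<Rightarrow> 'k K2 set \<Rightarrow> 'k K2 set \<Rightarrow> bool" where
  "t1lattice L M Lam \<longleftrightarrow> L \<subseteq> Lam \<and> Lam \<subseteq> M \<and> t1module Lam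
     \<and> (\<exists>S. finite S \<and> S \<subseteq> M \<and> Lam = ssum L (t1span S))
     \<and> (\<forall>m\<in>M. \<exists>c lam. lam \<in> Lam \<and> m - fls_const c * lam \<in> L)"

(* Subspaces of A/C are represented by their preimages U with C \<subseteq> U \<subseteq> A.
   Gr(A/C): subspaces commensurable with a member ((Lam \<inter> A) + C)/C of the
   filtration induced by the k[[t1]]-lattices of M/L. *)
definition Gr :: "'k::field K2 set \<Rightarrow> 'k K2 set \<Rightarrow> 'k K2 set set" where
  "Gr A C = {U. kspace U \<and> C \<subseteq> U \<and> U \<subseteq> A \<and>
     (\<exists>L M Lam. OK_lattice L \<and> OK_lattice M \<and> L \<subseteq> M \<and> L \<subseteq> C \<and> A \<subseteq> M \<and>
        t1lattice L M Lam \<and> commens U (ssum (Lam \<inter> A) C))}"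

definition Dim :: "'k::field K2 set \<Rightarrow> 'k K2 set \<Rightarrow> 'k dimth set" where
  "Dim A C = {d. (\<forall>U. U \<notin> Gr A C \<longrightarrow> d U = 0) \<and>
     (\<forall>U1\<in>Gr A C. \<forall>U2\<in>Gr A C. d U2 = d U1 + relidx U1 U2)}"

definition dadd :: "'k::field K2 set set \<Rightarrow> 'k dimth \<Rightarrow> int \<Rightarrow> 'k dimth" where
  "dadd G d n = (\<lambda>U. if U \<in> G then d U + n else 0)"

definition TorHom :: "'k::field K2 set \<Rightarrow> 'k K2 set \<Rightarrow> 'k K2 set \<Rightarrow> 'k thom set" where
  "TorHom A B C = {phi \<in> Dim A C \<rightarrow>\<^sub>E Dim B C.
     \<forall>x\<in>Dim A C. \<forall>n. phi (dadd (Gr A C) x n) = dadd (Gr B C) (phi x) n}"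

(* identification Dim(C/C') \<odot> Dim(A/C) \<cong> Dim(A/C') for C' \<subseteq> C \<subseteq> A:
   (d',d'') \<mapsto> (U \<mapsto> d'(alpha^-1 U) + d''(beta U)) *)
definition glue :: "'k::field K2 set \<Rightarrow> 'k K2 set \<Rightarrow> 'k K2 set \<Rightarrow> 'k dimth \<Rightarrow> 'k dimth \<Rightarrow> 'k dimth" where
  "glue A C C' e x = (\<lambda>U. if U \<in> Gr A C' then e (U \<inter> C) + x (ssum U C) else 0)"

(* transition map phi \<mapsto> phi \<odot> id_{Dim(C/C')} *)
definition trans :: "'k::field K2 set \<Rightarrow> 'k K2 set \<Rightarrow> 'k K2 set \<Rightarrow> 'k K2 set \<Rightarrow> 'k thom \<Rightarrow> 'k thom" where
  "trans A B C C' phi = (\<lambda>y\<in>Dim A C'.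
     (case SOME p. fst p \<in> Dim C C' \<and> snd p \<in> Dim A C \<and> glue A C C' (fst p) (snd p) = y of
        (e, x) \<Rightarrow> glue B C C' e (phi x)))"

section \<open>The torsor [[A|B]] as a direct limit\<close>

definition Idx :: "'k::field K2 set \<Rightarrow> 'k K2 set \<Rightarrow> 'k K2 set set" where
  "Idx A B = {C. kspace C \<and> C \<subseteq> A \<inter> B \<and> approx C A}"

definition Rep :: "'k::field K2 set \<Rightarrow> 'k K2 set \<Rightarrow> ('k K2 set \<times> 'k thom) set" where
  "Rep A B = {(C, phi). C \<in> Idx A B \<and> phi \<in> TorHom A B C}"

definition eqv :: "'k::field K2 set \<Rightarrow> 'k K2 set \<Rightarrow> ('k K2 set \<times> 'k thom) \<Rightarrow> ('k K2 set \<times> 'k thom) \<Rightarrow> bool" where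
  "eqv A B p q \<longleftrightarrow> p \<in> Rep A B \<and> q \<in> Rep A B \<and>
     (\<exists>C'\<in>Idx A B. C' \<subseteq> fst p \<inter> fst q \<and> trans A B (fst p) C' (snd p) = trans A B (fst q) C' (snd q))"

definition cls :: "'k::field K2 set \<Rightarrow> 'k K2 set \<Rightarrow> ('k K2 set \<times> 'k thom) \<Rightarrow> ('k K2 set \<times> 'k thom) set" where
  "cls A B p = {q. eqv A B q p}"

definition tor :: "'k::field K2 set \<Rightarrow> 'k K2 set \<Rightarrow> ('k K2 set \<times> 'k thom) set set" where
  "tor A B = cls A B ` Rep A B"

definition tshift :: "'k::field K2 set \<Rightarrow> 'k K2 set \<Rightarrow> int \<Rightarrow> ('k K2 set \<times> 'k thom) set \<Rightarrow> ('k K2 set \<times> 'k thom) set" where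
  "tshift A B n xi = (case SOME p. p \<in> xi of (C, phi) \<Rightarrow>
     cls A B (C, \<lambda>x\<in>Dim A C. dadd (Gr B C) (phi x) n))"

definition tcomp :: "'k::field K2 set \<Rightarrow> 'k K2 set \<Rightarrow> 'k K2 set \<Rightarrow> ('k K2 set \<times> 'k thom) set \<Rightarrow> ('k K2 set \<times> 'k thom) set \<Rightarrow> ('k K2 set \<times> 'k thom) set" where
  "tcomp A B D xi eta = cls A D (SOME q. \<exists>C1 phi1 C2 phi2 C'. (C1, phi1) \<in> xi \<and> (C2, phi2) \<in> eta \<and>
     C' \<in> Idx A B \<and> C' \<in> Idx B D \<and> C' \<in> Idx A D \<and> C' \<subseteq> C1 \<inter> C2 \<and>
     q = (C', compose (Dim A C') (trans B D C2 C' phi2) (trans A B C1 C' phi1)))"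

definition hact :: "'k::field K2 \<Rightarrow> 'k dimth \<Rightarrow> 'k dimth" where
  "hact h d = (\<lambda>U. d (mulset (inverse h) U))"

definition tact :: "'k::field K2 \<Rightarrow> 'k K2 set \<Rightarrow> 'k K2 set \<Rightarrow> ('k K2 set \<times> 'k thom) set \<Rightarrow> ('k K2 set \<times> 'k thom) set" where
  "tact h A B xi = (case SOME p. p \<in> xi of (C, phi) \<Rightarrow>
     cls (mulset h A) (mulset h B)
       (mulset h C, \<lambda>y\<in>Dim (mulset h A) (mulset h C). hact h (phi (hact (inverse h) y))))"

definition GVL :: "'k::field K2 set \<Rightarrow> ('k K2 \<times> ('k K2 set \<times> 'k thom) set) set" where
  "GVL L = {(h, d). h \<noteq> 0 \<and> d \<in> tor L (mulset h L)}"

definition gmul :: "'k::field K2 set \<Rightarrow> ('k K2 \<times> ('k K2 set \<times> 'k thom) set) \<Rightarrow> ('k K2 \<times> ('k K2 set \<times> 'k thom) set)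
     \<Rightarrow> ('k K2 \<times> ('k K2 set \<times> 'k thom) set)" where
  "gmul L a b = (case a of (h, d) \<Rightarrow> case b of (g, d') \<Rightarrow>
     (h * g, tcomp L (mulset h L) (mulset h (mulset g L)) d (tact h L (mulset g L) d')))"

definition psiV :: "'k::field K2 set \<Rightarrow> 'k K2 \<Rightarrow> 'k K2 \<Rightarrow> int" where
  "psiV L f g = (THE n. \<forall>F G. F \<in> GVL L \<and> fst F = f \<and> G \<in> GVL L \<and> fst G = g \<longrightarrow>
      snd (gmul L F G) = tshift L (mulset (f * g) L) n (snd (gmul L G F)))"

end

theory Submission
  imports Defs
begin

text \<open>Let \<open>E = k[[t\<^sub>1]]((t\<^sub>2))\<close>. Whenever \<open>C \<subseteq> A\<close> both lie between powers of the maximal ideal, \<open>(E \<inter> A) + C\<close>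
  belongs to \<open>Gr A C\<close>; normalising a dimension theory by its value there trivialises the torsor
  \<open>Dim A C\<close>, and these trivialisations are compatible with gluing because \<open>((E \<inter> A) + D) \<inter> C = (E \<inter> C) + D\<close>
  for \<open>D \<subseteq> C \<subseteq> A\<close>. Hence every \<open>[[A|B]]\<close> is identified with the integers, and the cocycle of the
  extension comes only from the failure of \<open>h\<close> to preserve \<open>E\<close>. By additivity this defect is a sum over
  the graded pieces \<open>t\<^sub>2\<^sup>i O\<^sub>K / t\<^sub>2\<^sup>i\<^sup>+\<^sup>1 O\<^sub>K\<close>; each is a copy of \<open>k((t\<^sub>1))\<close> on which \<open>h\<close> moves \<open>k[[t\<^sub>1]]\<close> by an index
  \<open>- \<nu>\<^sub>1(h)\<close>, and \<open>\<nu>\<^sub>2(g)\<close> of them separate \<open>O\<^sub>K\<close> from \<open>g O\<^sub>K\<close>.\<close>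

text \<open>The definitions pick representatives with \<open>SOME\<close>, take a
  \<open>LEAST\<close> spanning number and quantify over lattices. The proof attaches an integer
  label to every object (\<open>dimth\<close>, \<open>thom\<close>, \<open>tcls\<close>) and shows
  that no choice affects the label; composition, shift and action then become integer arithmetic.

  \<open>E\<close> itself lies between no two lattices. But once \<open>C\<close> contains
  \<open>ideal2 m\<close>, the \<open>t2\<close>-degrees from \<open>m\<close> on are invisible in
  \<open>A/C\<close>; finitely many copies of \<open>k((t1))\<close> remain, in which
  \<open>k[[t1]]\<close> is a lattice.

  The defect of \<open>h\<close> on \<open>A/C\<close> depends on \<open>C\<close> in general; its
  difference between \<open>A/C\<close> and \<open>B/C\<close> does not when \<open>A\<close> and
  \<open>B\<close> are lattices. The sign arises because \<open>[U1|U2]\<close> is dimension of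
  \<open>U2\<close> minus dimension of \<open>U1\<close>, and \<open>t1\<close> shrinks
  \<open>k[[t1]]\<close>. The resulting cocycle \<open>- nu1 f * nu2 g\<close> is not symmetric, and
  its antisymmetrisation is \<open>- nuK f g\<close>.\<close>

unbundle fps_syntax

section \<open>Relative dimensions of k-subspaces\<close>

text \<open>Makes basis extension and extension of linear maps available for the explicitly defined
  \<open>kspace\<close> and \<open>kspan\<close>.\<close>

interpretation KV: vector_space "\<lambda>c x. kc c * (x :: 'k::field K2)"
  by unfold_locales
    (simp_all add: kc_def algebra_simps fls_plus_const [symmetric] flip: fls_const_mult_const)

interpretation KV2: vector_space_pair
  "\<lambda>c x. kc c * (x :: 'k::field K2)" "\<lambda>c x. kc c * (x :: 'k::field K2)"
  by unfold_locales

lemma kspace_iff_subspace: "kspace A \<longleftrightarrow> KV.subspace A"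
  by (simp add: kspace_def KV.subspace_def)

lemma kspan_eq_span: "kspan S = KV.span S"
  by (simp add: kspan_def KV.span_def hull_def kspace_iff_subspace)

lemma kspace_zero: "kspace A \<Longrightarrow> 0 \<in> A"
  by (simp add: kspace_def)

lemma kspace_add: "kspace A \<Longrightarrow> x \<in> A \<Longrightarrow> y \<in> A \<Longrightarrow> x + y \<in> A"
  by (simp add: kspace_def)

lemma kspace_diff: "kspace A \<Longrightarrow> x \<in> A \<Longrightarrow> y \<in> A \<Longrightarrow> x - y \<in> A"
  by (simp add: kspace_iff_subspace KV.subspace_diff)

lemma kspace_Int: "kspace A \<Longrightarrow> kspace B \<Longrightarrow> kspace (A \<inter> B)"
  by (simp add: kspace_def)

lemma kspace_kspan: "kspace (kspan S)"
  by (simp add: kspan_eq_span kspace_iff_subspace)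

lemma kspan_superset: "S \<subseteq> kspan S"
  by (auto simp: kspan_def)

lemma kspan_minimal: "S \<subseteq> W \<Longrightarrow> kspace W \<Longrightarrow> kspan S \<subseteq> W"
  by (auto simp: kspan_def)

lemma ssum_kspan: "ssum (kspan S) (kspan T) = kspan (S \<union> T)"
  by (simp add: ssum_def kspan_eq_span KV.span_Un)

lemma kspan_kspace: "kspace A \<Longrightarrow> kspan A = A"
  using kspan_minimal kspan_superset by blast

lemma ssum_eq_kspan: "kspace A \<Longrightarrow> kspace B \<Longrightarrow> ssum A B = kspan (A \<union> B)"
  by (metis ssum_kspan kspan_kspace)

lemma kspace_ssum: "kspace A \<Longrightarrow> kspace B \<Longrightarrow> kspace (ssum A B)"
  by (simp add: ssum_eq_kspan kspace_kspan)

lemma ssumI: "x \<in> A \<Longrightarrow> y \<in> B \<Longrightarrow> x + y \<in> ssum A B"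
  by (auto simp: ssum_def)

lemma ssum_commute: "ssum A B = ssum B A"
  unfolding ssum_def by (auto; metis add.commute)

lemma ssum_upper1: "kspace B \<Longrightarrow> A \<subseteq> ssum A B"
proof
  fix a assume "kspace B" "a \<in> A"
  then show "a \<in> ssum A B"
    using ssumI[of a A 0 B] kspace_zero[of B] by simp
qed

lemma ssum_upper2: "kspace A \<Longrightarrow> B \<subseteq> ssum A B"
  by (metis ssum_commute ssum_upper1)

lemma ssum_least: "A \<subseteq> W \<Longrightarrow> B \<subseteq> W \<Longrightarrow> kspace W \<Longrightarrow> ssum A B \<subseteq> W"
  unfolding ssum_def using kspace_add by fastforce

lemma ssum_mono: "A \<subseteq> A' \<Longrightarrow> B \<subseteq> B' \<Longrightarrow> ssum A B \<subseteq> ssum A' B'"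
  unfolding ssum_def by fastforce

lemma ssum_absorb: "kspace A \<Longrightarrow> kspace B \<Longrightarrow> B \<subseteq> A \<Longrightarrow> ssum A B = A"
  by (meson order.refl ssum_least ssum_upper1 subset_antisym)

lemma ssum_assoc: "ssum (ssum A B) C = ssum A (ssum B C)"
proof -
  have "\<exists>u v. a + b + c = u + v \<and> u \<in> A \<and> (\<exists>x y. v = x + y \<and> x \<in> B \<and> y \<in> C)"
    if "a \<in> A" "b \<in> B" "c \<in> C" for a b c
    using that add.assoc[of a b c] by blast
  moreover have "\<exists>u v. a + (b + c) = u + v \<and> (\<exists>x y. u = x + y \<and> x \<in> A \<and> y \<in> B) \<and> v \<in> C"
    if "a \<in> A" "b \<in> B" "c \<in> C" for a b c
    using that add.assoc[of a b c, symmetric] by blast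
  ultimately show ?thesis
    unfolding ssum_def by blast
qed

lemma ssum_modular:
  assumes "kspace W" "A \<subseteq> W"
  shows "ssum A B \<inter> W = ssum A (B \<inter> W)"
proof -
  have "b \<in> W" if "a \<in> A" "a + b \<in> W" for a b
    using kspace_diff[OF assms(1) that(2), of a] that(1) assms(2) by auto
  then show ?thesis
    using assms unfolding ssum_def by (auto intro: kspace_add)
qed

section \<open>Relative dimension as the size of a relative basis\<close>

lemma qdim_le:
  assumes "finite S" "S \<subseteq> X" "X \<subseteq> ssum Y (kspan S)"
  shows "qdim X Y \<le> card S"
  unfolding qdim_def by (rule Least_le) (use assms in blast)

lemma qdim_witness:
  assumes "qfin X Y"
  obtains S where "finite S" "S \<subseteq> X" "card S = qdim X Y" "X \<subseteq> ssum Y (kspan S)"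
proof -
  have "\<exists>n S. finite S \<and> S \<subseteq> X \<and> card S = n \<and> X \<subseteq> ssum Y (kspan S)"
    using assms by (auto simp: qfin_def)
  from LeastI_ex[OF this] show thesis
    using that by (auto simp: qdim_def)
qed

text \<open>Apply the linear map that kills \<open>B\<close> and fixes \<open>T\<close>.\<close>

lemma relative_basis_bound:
  assumes ind: "KV.independent (B \<union> T)" and disj: "B \<inter> T = {}"
    and S: "finite S" and T: "T \<subseteq> kspan (B \<union> S)"
  shows "finite T \<and> card T \<le> card S"
proof -
  obtain p where lin: "Vector_Spaces.linear (\<lambda>c x. kc c * x) (\<lambda>c x. kc c * x) p"
    and p: "\<And>x. x \<in> B \<union> T \<Longrightarrow> p x = (if x \<in> B then 0 else x)"
    using KV2.linear_independent_extend[OF ind, of "\<lambda>x. if x \<in> B then 0 else x"] by blast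
  have "p ` T \<subseteq> p ` KV.span (B \<union> S)"
    using T by (auto simp: kspan_eq_span)
  also have "\<dots> = KV.span (p ` (B \<union> S))"
    using KV2.linear_span_image[OF lin] by simp
  also have "\<dots> \<subseteq> KV.span (p ` S)"
  proof (rule KV.span_minimal)
    show "p ` (B \<union> S) \<subseteq> KV.span (p ` S)"
      using p by (auto intro: KV.span_zero KV.span_base)
  qed simp
  finally have "T \<subseteq> KV.span (p ` S)"
    using p disj by (force simp: image_subset_iff)
  moreover have "KV.independent T"
    using ind KV.independent_mono by blast
  ultimately show ?thesis
    using KV.independent_span_bound[of "p ` S" T] S card_image_le[OF S, of p] by auto
qed

text \<open>\<open>T\<close> represents a basis of \<open>X/Y\<close>, so no spanning set of
  \<open>X\<close> over \<open>Y\<close> is smaller. This evaluates the \<open>LEAST\<close> in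
  \<open>qdim\<close> and turns additivity into counting.\<close>

lemma relative_basis_qfin:
  assumes ind: "KV.independent (B \<union> T)" and disj: "B \<inter> T = {}"
    and Y: "kspan B = Y" and X: "kspan (B \<union> T) = X"
  shows "qfin X Y \<longleftrightarrow> finite T" and "qfin X Y \<Longrightarrow> qdim X Y = card T"
proof -
  have sum: "ssum Y (kspan S) = kspan (B \<union> S)" for S
    by (simp add: ssum_kspan flip: Y)
  have TX: "T \<subseteq> X"
    using X kspan_superset by blast
  have bound: "finite T \<and> card T \<le> card S" if "finite S" "S \<subseteq> X" "X \<subseteq> ssum Y (kspan S)" for S
    using relative_basis_bound[OF ind disj that(1)] that TX sum by auto
  have fin: "qfin X Y" if "finite T"
    unfolding qfin_def using that TX X sum by blast
  show "qfin X Y \<longleftrightarrow> finite T"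
    using fin bound unfolding qfin_def by blast
  assume q: "qfin X Y"
  then obtain S where S: "finite S" "S \<subseteq> X" "card S = qdim X Y" "X \<subseteq> ssum Y (kspan S)"
    by (rule qdim_witness)
  then have "finite T" "card T \<le> qdim X Y"
    using bound by metis+
  moreover have "qdim X Y \<le> card T"
    by (rule qdim_le) (use \<open>finite T\<close> TX X sum in auto)
  ultimately show "qdim X Y = card T" by simp
qed

lemma adapted_basis:
  assumes "kspace X" "KV.independent B" "B \<subseteq> X"
  obtains T where "B \<inter> T = {}" "KV.independent (B \<union> T)" "kspan (B \<union> T) = X"
proof -
  obtain D where D: "B \<subseteq> D" "D \<subseteq> X" "KV.independent D" "X \<subseteq> KV.span D"
    using KV.maximal_independent_subset_extend[OF assms(3,2)] by blast
  have "kspan D = X"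
    using D assms(1) kspan_minimal[of D X] by (auto simp: kspan_eq_span)
  with D have "B \<inter> (D - B) = {}" "KV.independent (B \<union> (D - B))" "kspan (B \<union> (D - B)) = X"
    by (auto simp: Un_absorb1)
  then show thesis by (rule that)
qed

text \<open>Extending a basis of \<open>Z\<close> by \<open>T\<close> to \<open>Y\<close> and then
  by \<open>U\<close> to \<open>X\<close> makes \<open>T \<union> U\<close> a relative basis of
  \<open>X\<close> over \<open>Z\<close>, and cardinalities add.\<close>

lemma
  assumes Z: "kspace Z" and Y: "kspace Y" and X: "kspace X" and ZY: "Z \<subseteq> Y" and YX: "Y \<subseteq> X"
  shows qfin_tower: "qfin X Z \<longleftrightarrow> qfin X Y \<and> qfin Y Z"
    and qdim_tower: "qfin X Z \<Longrightarrow> qdim X Z = qdim X Y + qdim Y Z"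
proof -
  obtain B where B: "KV.independent B" "kspan B = Z"
    using adapted_basis[OF Z KV.independent_empty] by auto
  have "B \<subseteq> Y"
    using B ZY kspan_superset by blast
  then obtain T where T: "B \<inter> T = {}" "KV.independent (B \<union> T)" "kspan (B \<union> T) = Y"
    using adapted_basis[OF Y B(1)] by blast
  have "B \<union> T \<subseteq> X"
    using T YX kspan_superset by blast
  then obtain U where U: "(B \<union> T) \<inter> U = {}" "KV.independent (B \<union> T \<union> U)" "kspan (B \<union> T \<union> U) = X"
    using adapted_basis[OF X T(2)] by blast
  note YZ = relative_basis_qfin[OF T(2,1) B(2) T(3)]
  note XY = relative_basis_qfin[OF U(2,1) T(3) U(3)]
  have "KV.independent (B \<union> (T \<union> U))" "B \<inter> (T \<union> U) = {}" "kspan (B \<union> (T \<union> U)) = X"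
    using U T by (auto simp: Un_assoc)
  note XZ = relative_basis_qfin[OF this(1,2) B(2) this(3)]
  show eq: "qfin X Z \<longleftrightarrow> qfin X Y \<and> qfin Y Z"
    using XZ(1) XY(1) YZ(1) by auto
  assume q: "qfin X Z"
  moreover have "card (T \<union> U) = card T + card U"
    using q U XZ(1) by (intro card_Un_disjoint) auto
  ultimately show "qdim X Z = qdim X Y + qdim Y Z"
    using XZ(2) XY(2) YZ(2) eq by simp
qed

text \<open>One half of \<open>(X + Y)/Y = X/(X \<inter> Y)\<close>. Generators are replaced by
  their \<open>X\<close>-components, since spanning sets must lie inside \<open>X\<close>; the
  modular law then cuts \<open>Y\<close> down to \<open>X \<inter> Y\<close>.\<close>

lemma ssum_project:
  assumes X: "kspace X" and Y: "kspace Y"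
    and S: "finite S" "S \<subseteq> ssum X Y" "ssum X Y \<subseteq> ssum Y (kspan S)"
  obtains S' where "finite S'" "S' \<subseteq> X" "card S' \<le> card S" "X \<subseteq> ssum (X \<inter> Y) (kspan S')"
proof -
  have "\<exists>p. \<forall>s\<in>S. p s \<in> X \<and> s - p s \<in> Y"
  proof (rule bchoice, rule ballI)
    fix s assume "s \<in> S"
    then obtain x y where "x \<in> X" "y \<in> Y" "s = x + y"
      using S(2) by (auto simp: ssum_def)
    then show "\<exists>x. x \<in> X \<and> s - x \<in> Y"
      by (intro exI[of _ x]) simp
  qed
  then obtain p where p: "\<And>s. s \<in> S \<Longrightarrow> p s \<in> X" "\<And>s. s \<in> S \<Longrightarrow> s - p s \<in> Y"
    by blast
  have sub: "kspan (p ` S) \<subseteq> X"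
    using p X by (intro kspan_minimal) auto
  have ks: "kspace (ssum Y (kspan (p ` S)))"
    by (intro kspace_ssum Y kspace_kspan)
  have "s \<in> ssum Y (kspan (p ` S))" if "s \<in> S" for s
  proof -
    have "p s \<in> kspan (p ` S)"
      using that kspan_superset by blast
    then show ?thesis
      using ssumI[OF p(2)[OF that], of "p s"] by simp
  qed
  then have "kspan S \<subseteq> ssum Y (kspan (p ` S))"
    by (intro kspan_minimal ks) auto
  then have "X \<subseteq> ssum Y (kspan (p ` S))"
    using S(3) ssum_upper1[OF Y, of X] ssum_least[OF _ _ ks] ssum_upper1[OF kspace_kspan] by blast
  then have "X = ssum (kspan (p ` S)) Y \<inter> X"
    by (auto simp: ssum_commute)
  also have "\<dots> = ssum (kspan (p ` S)) (Y \<inter> X)"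
    using sub X by (rule ssum_modular[rotated])
  finally have "X \<subseteq> ssum (X \<inter> Y) (kspan (p ` S))"
    by (simp add: ssum_commute Int_commute)
  then show thesis
    by (intro that[of "p ` S"]) (use S p in \<open>auto intro: card_image_le\<close>)
qed

lemma ssum_lift:
  assumes X: "kspace X" and Y: "kspace Y"
    and S: "S \<subseteq> X" "X \<subseteq> ssum (X \<inter> Y) (kspan S)"
  shows "S \<subseteq> ssum X Y" "ssum X Y \<subseteq> ssum Y (kspan S)"
proof -
  show "S \<subseteq> ssum X Y"
    using S ssum_upper1[OF Y] by blast
  show "ssum X Y \<subseteq> ssum Y (kspan S)"
    using S(2) ssum_mono[of "X \<inter> Y" Y "kspan S" "kspan S"] ssum_upper1[OF kspace_kspan, of Y S]
    by (intro ssum_least kspace_ssum Y kspace_kspan) auto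
qed

text \<open>The second isomorphism theorem, by transporting minimal spanning sets in both
  directions.\<close>

lemma
  assumes X: "kspace X" and Y: "kspace Y"
  shows qfin_ssum: "qfin (ssum X Y) Y \<longleftrightarrow> qfin X (X \<inter> Y)"
    and qdim_ssum: "qfin X (X \<inter> Y) \<Longrightarrow> qdim (ssum X Y) Y = qdim X (X \<inter> Y)"
proof -
  show eq: "qfin (ssum X Y) Y \<longleftrightarrow> qfin X (X \<inter> Y)"
    unfolding qfin_def using ssum_project[OF X Y] ssum_lift[OF X Y] by metis
  assume q: "qfin X (X \<inter> Y)"
  show "qdim (ssum X Y) Y = qdim X (X \<inter> Y)"
  proof (rule antisym)
    from q obtain S where S: "finite S" "S \<subseteq> X" "card S = qdim X (X \<inter> Y)" "X \<subseteq> ssum (X \<inter> Y) (kspan S)"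
      by (rule qdim_witness)
    then show "qdim (ssum X Y) Y \<le> qdim X (X \<inter> Y)"
      using qdim_le[OF S(1) ssum_lift[OF X Y S(2,4)]] by simp
    from q eq have "qfin (ssum X Y) Y" by simp
    then obtain S where S: "finite S" "S \<subseteq> ssum X Y" "card S = qdim (ssum X Y) Y"
        "ssum X Y \<subseteq> ssum Y (kspan S)"
      by (rule qdim_witness)
    obtain S' where "finite S'" "S' \<subseteq> X" "card S' \<le> card S" "X \<subseteq> ssum (X \<inter> Y) (kspan S')"
      by (rule ssum_project[OF X Y S(1,2,4)])
    then show "qdim X (X \<inter> Y) \<le> qdim (ssum X Y) Y"
      using qdim_le[of S' X "X \<inter> Y"] S(3) by simp
  qed
qed

text \<open>With \<open>W = V + (U \<inter> C)\<close>, the second isomorphism theorem identifies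
  \<open>W/V\<close> with \<open>(U \<inter> C)/(V \<inter> C)\<close> and \<open>U/W\<close> with
  \<open>(U + C)/(V + C)\<close>.\<close>

lemma
  assumes U: "kspace U" and V: "kspace V" and C: "kspace C" and VU: "V \<subseteq> U"
  shows qfin_split: "qfin U V \<longleftrightarrow> qfin (U \<inter> C) (V \<inter> C) \<and> qfin (ssum U C) (ssum V C)"
    and qdim_split: "qfin U V \<Longrightarrow> qdim U V = qdim (U \<inter> C) (V \<inter> C) + qdim (ssum U C) (ssum V C)"
proof -
  let ?W = "ssum V (U \<inter> C)"
  have kW: "kspace ?W" "kspace (U \<inter> C)" "kspace (ssum V C)"
    using U V C by (simp_all add: kspace_ssum kspace_Int)
  have W: "V \<subseteq> ?W" "?W \<subseteq> U"
    using VU ssum_upper1[OF kW(2)] ssum_least[OF VU _ U, of "U \<inter> C"] by auto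
  have 1: "ssum (U \<inter> C) V = ?W" "U \<inter> C \<inter> V = V \<inter> C"
    using VU by (auto simp: ssum_commute)
  have 2: "ssum U (ssum V C) = ssum U C"
    using ssum_absorb[OF U V VU] by (simp flip: ssum_assoc)
  have 3: "U \<inter> ssum V C = ?W"
    using ssum_modular[OF U VU, of C] by (simp add: Int_commute)
  note a = qfin_ssum[OF kW(2) V] qdim_ssum[OF kW(2) V]
  note b = qfin_ssum[OF U kW(3)] qdim_ssum[OF U kW(3)]
  note c = qfin_tower[OF V kW(1) U W] qdim_tower[OF V kW(1) U W]
  show "qfin U V \<longleftrightarrow> qfin (U \<inter> C) (V \<inter> C) \<and> qfin (ssum U C) (ssum V C)"
    using a(1) b(1) c(1) unfolding 1 2 3 by auto
  assume "qfin U V"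
  then show "qdim U V = qdim (U \<inter> C) (V \<inter> C) + qdim (ssum U C) (ssum V C)"
    using a b c unfolding 1 2 3 by auto
qed

lemma qfin_refl: "qfin X X"
  unfolding qfin_def using ssum_upper1[OF kspace_kspan, of X "{}"] by blast

lemma qdim_refl: "qdim X X = 0"
  using qdim_le[of "{}" X X] ssum_upper1[OF kspace_kspan, of X "{}"] by simp

lemma qfin_mono:
  assumes "kspace X" "kspace Y" "kspace X'" "kspace Y'"
    and "Y \<subseteq> Y'" "Y' \<subseteq> X'" "X' \<subseteq> X" "qfin X Y"
  shows "qfin X' Y'"
  using qfin_tower[of Y X' X] qfin_tower[of Y Y' X'] assms by auto

section \<open>Commensurability and the relative index\<close>

lemma commens_sym: "commens U V \<Longrightarrow> commens V U"
  by (simp add: commens_def Int_commute)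

lemma commens_refl: "commens U U"
  by (simp add: commens_def qfin_refl)

lemma commens_if_qfin: "V \<subseteq> U \<Longrightarrow> qfin U V \<Longrightarrow> commens U V"
  by (simp add: commens_def Int_absorb1 qfin_refl)

text \<open>A finite quotient of \<open>U2\<close> stays finite when cut by \<open>U1\<close> or by
  \<open>U3\<close>, so the triple intersection can serve as one reference space for all
  three.\<close>

lemma commens_common:
  assumes "kspace U1" "kspace U2" "kspace U3" "commens U1 U2" "commens U2 U3"
  shows "qfin U1 (U1 \<inter> U2 \<inter> U3)" "qfin U2 (U1 \<inter> U2 \<inter> U3)" "qfin U3 (U1 \<inter> U2 \<inter> U3)"
proof -
  note k = kspace_Int[OF assms(1,2)] kspace_Int[OF assms(2,3)]
  have kV: "kspace (U1 \<inter> U2 \<inter> U3)"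
    using assms by (intro kspace_Int)
  have q: "qfin U1 (U1 \<inter> U2)" "qfin U2 (U1 \<inter> U2)" "qfin U2 (U2 \<inter> U3)" "qfin U3 (U2 \<inter> U3)"
    using assms(4,5) by (auto simp: commens_def Int_commute)
  have a: "qfin (U1 \<inter> U2) (U1 \<inter> U2 \<inter> U3)"
    using qfin_split[OF assms(2) k(2) assms(1)] q(3) by (auto simp: Int_ac)
  have b: "qfin (U2 \<inter> U3) (U1 \<inter> U2 \<inter> U3)"
    using qfin_split[OF assms(2) k(1) assms(3)] q(2) by (auto simp: Int_ac)
  show "qfin U1 (U1 \<inter> U2 \<inter> U3)"
    using qfin_tower[OF kV k(1) assms(1)] q a by auto
  show "qfin U2 (U1 \<inter> U2 \<inter> U3)"
    using qfin_tower[OF kV k(1) assms(2)] q a by auto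
  show "qfin U3 (U1 \<inter> U2 \<inter> U3)"
    using qfin_tower[OF kV k(2) assms(3)] q b by auto
qed

text \<open>Passing from \<open>U1 \<inter> U2\<close> down to \<open>V\<close> adds the same term
  to both dimensions. With a single reference space, indices telescope.\<close>

lemma relidx_common:
  assumes k: "kspace U1" "kspace U2" "kspace V" and V: "V \<subseteq> U1" "V \<subseteq> U2"
    and q: "qfin U1 V" "qfin U2 V"
  shows "relidx U1 U2 = int (qdim U2 V) - int (qdim U1 V)"
proof -
  have kI: "kspace (U1 \<inter> U2)" using k by (simp add: kspace_Int)
  show ?thesis
    using qdim_tower[OF k(3) kI k(1)] qdim_tower[OF k(3) kI k(2)] V q
    by (simp add: relidx_def)
qed

lemma commensI:
  assumes k: "kspace U1" "kspace U2" "kspace V" and V: "V \<subseteq> U1" "V \<subseteq> U2"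
    and q: "qfin U1 V" "qfin U2 V"
  shows "commens U1 U2"
  unfolding commens_def
  using qfin_mono[OF k(1) k(3) k(1) kspace_Int[OF k(1,2)]] 
    qfin_mono[OF k(2) k(3) k(2) kspace_Int[OF k(1,2)]] V q by auto

lemma commens_trans:
  assumes "kspace U1" "kspace U2" "kspace U3" "commens U1 U2" "commens U2 U3"
  shows "commens U1 U3"
  using commensI[OF assms(1,3) _ _ _ commens_common(1,3)[OF assms]] assms
  by (auto intro: kspace_Int)

lemma relidx_cocycle:
  assumes "kspace U1" "kspace U2" "kspace U3" "commens U1 U2" "commens U2 U3"
  shows "relidx U1 U3 = relidx U1 U2 + relidx U2 U3"
proof -
  have "kspace (U1 \<inter> U2 \<inter> U3)"
    using assms by (intro kspace_Int)
  note r = relidx_common[OF _ _ this]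
  show ?thesis
    using r[of U1 U2] r[of U2 U3] r[of U1 U3] commens_common[OF assms] assms(1,2,3)
    by fastforce
qed

lemma relidx_refl: "relidx U U = 0"
  by (simp add: relidx_def)

lemma relidx_swap: "relidx U V = - relidx V U"
  by (simp add: relidx_def Int_commute)

text \<open>Apply \<open>qdim_split\<close> to \<open>U\<close> and to \<open>V\<close> over
  \<open>U \<inter> V\<close> and subtract. This additivity along \<open>C\<close> and the quotient
  by \<open>C\<close> underlies both gluing and the splitting of \<open>mshift\<close>.\<close>

lemma
  assumes k: "kspace U" "kspace V" "kspace C" and UV: "commens U V"
  shows commens_Int: "commens (U \<inter> C) (V \<inter> C)"
    and commens_ssum: "commens (ssum U C) (ssum V C)"
    and relidx_split: "relidx U V = relidx (U \<inter> C) (V \<inter> C) + relidx (ssum U C) (ssum V C)"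
proof -
  let ?W = "U \<inter> V"
  have kW: "kspace ?W" using k by (simp add: kspace_Int)
  have q: "qfin U ?W" "qfin V ?W" using UV by (auto simp: commens_def)
  note sU = qfin_split[OF k(1) kW k(3)] qdim_split[OF k(1) kW k(3)]
  note sV = qfin_split[OF k(2) kW k(3)] qdim_split[OF k(2) kW k(3)]
  have qI: "qfin (U \<inter> C) (?W \<inter> C)" "qfin (V \<inter> C) (?W \<inter> C)"
    and qS: "qfin (ssum U C) (ssum ?W C)" "qfin (ssum V C) (ssum ?W C)"
    using sU(1) sV(1) q by auto
  \<comment> \<open>\<open>(U \<inter> V) + C\<close> can be smaller than the intersection of
    \<open>U + C\<close> and \<open>V + C\<close>, hence the use of \<open>relidx_common\<close>
    below.\<close>
  have sub: "ssum ?W C \<subseteq> ssum U C" "ssum ?W C \<subseteq> ssum V C"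
    by (intro ssum_mono; blast)+
  show "commens (U \<inter> C) (V \<inter> C)"
    by (rule commensI[OF _ _ _ _ _ qI]) (use k kW in \<open>auto intro: kspace_Int\<close>)
  show "commens (ssum U C) (ssum V C)"
    by (rule commensI[OF _ _ _ sub qS]) (use k kW in \<open>auto intro: kspace_ssum\<close>)
  have "relidx (U \<inter> C) (V \<inter> C) = int (qdim (V \<inter> C) (?W \<inter> C)) - int (qdim (U \<inter> C) (?W \<inter> C))"
    by (rule relidx_common[OF _ _ _ _ _ qI]) (use k kW in \<open>auto intro: kspace_Int\<close>)
  moreover have "relidx (ssum U C) (ssum V C)
      = int (qdim (ssum V C) (ssum ?W C)) - int (qdim (ssum U C) (ssum ?W C))"
    by (rule relidx_common[OF _ _ _ sub qS]) (use k kW in \<open>auto intro: kspace_ssum\<close>)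
  moreover have "relidx U V = int (qdim V ?W) - int (qdim U ?W)"
    by (simp add: relidx_def)
  ultimately show "relidx U V = relidx (U \<inter> C) (V \<inter> C) + relidx (ssum U C) (ssum V C)"
    using sU(2) sV(2) q by simp
qed

section \<open>Powers of the maximal ideal and truncated lattices\<close>

definition ideal2 :: "int \<Rightarrow> 'k::field K2 set" where
  "ideal2 n = {x. \<forall>i<n. x $$ i = 0}"

text \<open>Degrees from \<open>m\<close> on are left free, so for \<open>n \<le> m\<close> the set
  \<open>ideal2 n \<inter> trunc_lat m j\<close> is the preimage of the standard lattice
  \<open>t1^j k[[t1]]^(m-n)\<close> of \<open>ideal2 n / ideal2 m\<close>.\<close>

definition trunc_lat :: "int \<Rightarrow> int \<Rightarrow> 'k::field K2 set" where
  "trunc_lat m j = {x. \<forall>i<m. \<forall>l<j. x $$ i $$ l = 0}"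

definition EK :: "'k::field K2 set" where
  "EK = {x. \<forall>i. \<forall>l<0. x $$ i $$ l = 0}"

definition mon :: "int \<Rightarrow> int \<Rightarrow> 'k::field K2" where
  "mon i j = fls_const (fls_X_intpow j) * fls_X_intpow i"

text \<open>\<open>p\<close> and \<open>q\<close> are only lower bounds for the orders, and zero
  factors are allowed, so the rule serves for \<open>t2\<close>-coefficients and for the
  \<open>t1\<close>-coefficients inside them.\<close>

lemma fls_mult_vanish:
  fixes a b :: "'a::idom fls"
  assumes "\<forall>i<p. a $$ i = 0" "\<forall>i<q. b $$ i = 0"
  shows "n < p + q \<Longrightarrow> (a * b) $$ n = 0" and "(a * b) $$ (p + q) = a $$ p * b $$ q"
proof -
  consider "a = 0 \<or> b = 0" | "a \<noteq> 0" "b \<noteq> 0" by blast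
  then have "(n < p + q \<longrightarrow> (a * b) $$ n = 0) \<and> (a * b) $$ (p + q) = a $$ p * b $$ q"
  proof cases
    case 2
    have pq: "p \<le> fls_subdegree a" "q \<le> fls_subdegree b"
      using 2 assms by (auto intro!: fls_subdegree_geI)
    have sd: "fls_subdegree (a * b) = fls_subdegree a + fls_subdegree b"
      using 2 by simp
    have "(a * b) $$ (p + q) = a $$ p * b $$ q"
    proof (cases "p = fls_subdegree a \<and> q = fls_subdegree b")
      case True
      then show ?thesis by simp
    next
      case False
      then have "a $$ p * b $$ q = 0" "p + q < fls_subdegree (a * b)"
        using pq sd by auto
      then show ?thesis by simp
    qed
    moreover have "(a * b) $$ n = 0" if "n < p + q"
      using that pq sd by simp
    ultimately show ?thesis by blast
  qed auto
  then show "n < p + q \<Longrightarrow> (a * b) $$ n = 0" and "(a * b) $$ (p + q) = a $$ p * b $$ q"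
    by auto
qed

lemma const_intpow_nth: "(fls_const a * fls_X_intpow n) $$ i = (if i = n then a else 0)"
  for a :: "'a::field"
  by simp

lemma intpow_mult_nth [simp]: "(fls_shift a 1 * f) $$ l = f $$ (l + a)" for f :: "'a::field fls"
  using fls_X_intpow_times_conv_shift(1)[of "- a" f] by simp

lemma t1module_kspace: "t1module W \<Longrightarrow> kspace W"
  by (simp add: t1module_def kspace_def kc_def kt1_def)

lemma t1module_ideal2: "t1module (ideal2 n)"
  by (simp add: t1module_def ideal2_def)

lemma t1module_trunc_lat: "t1module (trunc_lat m j)"
  unfolding t1module_def trunc_lat_def kt1_def
  by (auto intro!: fls_mult_vanish(1)[of 0 _ j])

lemma t1module_Int: "t1module A \<Longrightarrow> t1module B \<Longrightarrow> t1module (A \<inter> B)"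
  by (auto simp: t1module_def)

lemma kspace_ideal2: "kspace (ideal2 n)"
  by (intro t1module_kspace t1module_ideal2)

lemma kspace_trunc_lat: "kspace (trunc_lat m j)"
  by (intro t1module_kspace t1module_trunc_lat)

lemma kspace_EK: "kspace EK"
  by (simp add: kspace_def EK_def kc_def)

lemma kspace_block: "kspace (ideal2 n \<inter> trunc_lat m j)"
  by (intro kspace_Int kspace_ideal2 kspace_trunc_lat)

lemma t1module_span: "t1module (t1span S)"
  by (auto simp: t1span_def t1module_def)

lemma t1span_superset: "S \<subseteq> t1span S"
  by (auto simp: t1span_def)

lemma t1span_minimal: "S \<subseteq> W \<Longrightarrow> t1module W \<Longrightarrow> t1span S \<subseteq> W"
  by (auto simp: t1span_def)

lemma t1module_ssum:
  assumes "t1module A" "t1module B"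
  shows "t1module (ssum A B)"
proof -
  have "kspace (ssum A B)"
    using assms by (intro kspace_ssum t1module_kspace)
  moreover have "fls_const a * x \<in> ssum A B" if a: "a \<in> kt1" and x: "x \<in> ssum A B" for a x
  proof -
    from x obtain u v where uv: "u \<in> A" "v \<in> B" "x = u + v"
      by (auto simp: ssum_def)
    then have "fls_const a * u \<in> A" "fls_const a * v \<in> B"
      using a assms by (auto simp: t1module_def)
    from ssumI[OF this] uv(3) show ?thesis
      by (simp add: distrib_left)
  qed
  ultimately show ?thesis
    by (simp add: t1module_def kspace_def)
qed

lemma ideal2_mono: "n \<le> m \<Longrightarrow> ideal2 m \<subseteq> ideal2 n"
  by (auto simp: ideal2_def)

lemma ideal2_trunc_lat: "ideal2 m \<subseteq> trunc_lat m j"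
  by (auto simp: ideal2_def trunc_lat_def)

lemma trunc_lat_mono: "j' \<le> j \<Longrightarrow> trunc_lat m j \<subseteq> trunc_lat m j'"
  by (auto simp: trunc_lat_def)

lemma mon_nth: "mon i j $$ p = (if p = i then fls_X_intpow j else 0)"
  unfolding mon_def by (rule const_intpow_nth)

lemma mon_shift: "mon i j = fls_const (fls_X_intpow j) * mon i 0"
  by (simp add: mon_def)

lemma intpow2_ideal2: "fls_X_intpow n \<in> ideal2 n"
  by (simp add: ideal2_def)

lemma ideal2_subset_iff: "(ideal2 m :: 'k::field K2 set) \<subseteq> ideal2 n \<longleftrightarrow> n \<le> m"
proof
  assume "(ideal2 m :: 'k K2 set) \<subseteq> ideal2 n"
  then have "(fls_X_intpow m :: 'k K2) \<in> ideal2 n"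
    using intpow2_ideal2 by blast
  then have "n \<le> fls_subdegree (fls_X_intpow m :: 'k K2)"
    by (intro fls_subdegree_geI) (auto simp: ideal2_def)
  then show "n \<le> m" by simp
qed (rule ideal2_mono)

section \<open>Generation of truncated lattices by monomials\<close>

lemma ideal2_peel:
  assumes "x \<in> ideal2 n \<inter> trunc_lat m j"
  shows "x - fls_const (x $$ n) * fls_X_intpow n \<in> ideal2 (n + 1) \<inter> trunc_lat m j"
proof -
  have "(x - fls_const (x $$ n) * fls_X_intpow n) $$ i = (if i = n then 0 else x $$ i)" for i
    by (simp only: fls_minus_nth const_intpow_nth) simp
  then show ?thesis
    using assms by (auto simp: ideal2_def trunc_lat_def)
qed

text \<open>Peel off one \<open>t2\<close>-degree at a time: a leading coefficient of order at least
  \<open>j\<close> is a \<open>k[[t1]]\<close>-multiple of \<open>t1^j\<close>.\<close>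

lemma block_subset_t1module:
  fixes W :: "'k::field K2 set"
  assumes W: "t1module W" "ideal2 m \<subseteq> W"
    and gen: "\<And>i. n \<le> i \<Longrightarrow> i < m \<Longrightarrow> mon i j \<in> W"
  shows "ideal2 n \<inter> trunc_lat m j \<subseteq> W"
  using gen
proof (induction "nat (m - n)" arbitrary: n)
  case 0
  then show ?case using ideal2_mono[of m n] W(2) by auto
next
  case (Suc k)
  show ?case
  proof
    fix x :: "'k K2" assume x: "x \<in> ideal2 n \<inter> trunc_lat m j"
    have n: "n < m" using Suc.hyps by simp
    \<comment> \<open>The leading coefficient divided by \<open>t1^j\<close>; the truncation
      condition makes it integral.\<close>
    let ?a = "fls_shift j (x $$ n)"
    have "?a * fls_X_intpow j = x $$ n"
      by (simp add: fls_X_intpow_times_conv_shift)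
    then have "fls_const ?a * mon n j = fls_const (x $$ n) * fls_X_intpow n"
      unfolding mon_def by (simp only: mult.assoc [symmetric] fls_const_mult_const)
    moreover have "?a \<in> kt1"
      using x n by (auto simp: kt1_def trunc_lat_def)
    ultimately have "fls_const (x $$ n) * fls_X_intpow n \<in> W"
      using W(1) Suc.prems[of n] n unfolding t1module_def by (metis order.refl)
    moreover have "x - fls_const (x $$ n) * fls_X_intpow n \<in> W"
      using Suc.hyps(1)[of "n + 1"] Suc.hyps(2) Suc.prems ideal2_peel[OF x] by force
    ultimately show "x \<in> W"
      using kspace_add[OF t1module_kspace[OF W(1)]] by fastforce
  qed
qed

text \<open>With scalars from \<open>k\<close> alone, the \<open>t1\<close>-order can drop by just
  one: a leading coefficient differs from a scalar multiple of \<open>t1^j\<close> by a series of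
  order at least \<open>j + 1\<close>.\<close>

lemma block_subset_kspace:
  fixes W :: "'k::field K2 set"
  assumes W: "kspace W" "ideal2 n \<inter> trunc_lat m (j + 1) \<subseteq> W"
    and gen: "\<And>i. n \<le> i \<Longrightarrow> i < m \<Longrightarrow> mon i j \<in> W"
  shows "ideal2 n \<inter> trunc_lat m j \<subseteq> W"
  using W(2) gen
proof (induction "nat (m - n)" arbitrary: n)
  case 0
  then show ?case using ideal2_mono[of m n] ideal2_trunc_lat[of m "j+1"] by auto
next
  case (Suc k)
  show ?case
  proof
    fix x :: "'k K2" assume x: "x \<in> ideal2 n \<inter> trunc_lat m j"
    have n: "n < m" using Suc.hyps by simp
    define c where "c = x $$ n $$ j"
    define b where "b = x $$ n - fls_const c * fls_X_intpow j"
    have b: "b $$ l = (if l = j then 0 else x $$ n $$ l)" for l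
      unfolding b_def by (simp only: fls_minus_nth const_intpow_nth) (simp add: c_def)
    \<comment> \<open>Three pieces: the \<open>t1^j t2^n\<close> term, the rest of the
      \<open>t2^n\<close> coefficient, and the higher \<open>t2\<close>-degrees.\<close>
    have eq: "x = kc c * mon n j + fls_const b * fls_X_intpow n + (x - fls_const (x $$ n) * fls_X_intpow n)"
      unfolding b_def mon_def kc_def
      by (simp add: algebra_simps flip: fls_minus_const fls_const_mult_const)
    have "kc c * mon n j \<in> W"
      using W(1) Suc.prems(2)[of n] n by (simp add: kspace_def)
    moreover have "fls_const b * fls_X_intpow n \<in> ideal2 n \<inter> trunc_lat m (j + 1)"
      using x n unfolding ideal2_def trunc_lat_def
      by (auto simp only: const_intpow_nth mem_Collect_eq Int_iff b split: if_splits) auto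
    then have "fls_const b * fls_X_intpow n \<in> W"
      using Suc.prems by blast
    moreover have "ideal2 (n + 1) \<inter> trunc_lat m (j + 1) \<subseteq> W"
      using Suc.prems(1) ideal2_mono[of n "n + 1"] by auto
    then have "x - fls_const (x $$ n) * fls_X_intpow n \<in> W"
      using Suc.hyps(1)[of "n + 1"] Suc.hyps(2) Suc.prems ideal2_peel[OF x] by force
    ultimately show "x \<in> W"
      by (subst eq) (intro kspace_add W(1))
  qed
qed

lemma block_step:
  "ideal2 n \<inter> trunc_lat m j \<subseteq> ssum (ideal2 n \<inter> trunc_lat m (j + 1)) (kspan ((\<lambda>i. mon i j) ` {n..<m}))"
proof (rule block_subset_kspace)
  fix i :: int assume "n \<le> i" "i < m"
  then have "mon i j \<in> kspan ((\<lambda>i. mon i j) ` {n..<m})"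
    by (intro subsetD[OF kspan_superset]) auto
  then show "mon i j \<in> ssum (ideal2 n \<inter> trunc_lat m (j + 1)) (kspan ((\<lambda>i. mon i j) ` {n..<m}))"
    using ssum_upper2[OF kspace_block] by blast
qed (intro kspace_ssum kspace_block kspace_kspan ssum_upper1)+

lemma mon_block: "n \<le> i \<Longrightarrow> mon i j \<in> ideal2 n \<inter> trunc_lat m j"
  by (auto simp: ideal2_def trunc_lat_def mon_nth)

lemma qfin_block:
  assumes "j' \<le> j"
  shows "qfin (ideal2 n \<inter> trunc_lat m j') (ideal2 n \<inter> trunc_lat m j)"
  using assms
proof (induction j rule: int_ge_induct)
  case base
  show ?case by (rule qfin_refl)
next
  case (step j)
  have "qfin (ideal2 n \<inter> trunc_lat m j) (ideal2 n \<inter> trunc_lat m (j + 1))"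
    unfolding qfin_def
    by (intro exI[of _ "(\<lambda>i. mon i j) ` {n..<m}"] conjI block_step image_subsetI mon_block) auto
  then show ?case
    using step qfin_tower[OF kspace_block kspace_block kspace_block, of n m "j + 1" n m j n m j']
      trunc_lat_mono[of j "j + 1" m] trunc_lat_mono[of j' j m] by auto
qed

lemma trunc_lat_exhaust: "\<exists>N. \<forall>j\<le>N. x \<in> trunc_lat m j"
proof -
  let ?s = "\<lambda>i. fls_subdegree (x $$ i)"
  \<comment> \<open>Only finitely many coefficients below \<open>m\<close> can be nonzero; the extra
    0 keeps the minimum defined if the range is empty.\<close>
  define N where "N = Min (insert 0 (?s ` {fls_subdegree x..<m}))"
  have "x $$ i $$ l = 0" if "i < m" "l < N" for i l
  proof (cases "i < fls_subdegree x")
    case False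
    then have "N \<le> ?s i"
      using that unfolding N_def by (intro Min_le) auto
    then show ?thesis using that by simp
  qed simp
  then show ?thesis
    by (intro exI[of _ N]) (auto simp: trunc_lat_def)
qed

lemma trunc_lat_exhaust_finite:
  fixes S :: "'k::field K2 set"
  assumes "finite S"
  obtains N where "\<And>x. x \<in> S \<Longrightarrow> x \<in> trunc_lat m N"
proof -
  obtain N where N: "\<forall>x::'k K2. \<forall>j\<le>N x. x \<in> trunc_lat m j"
    using trunc_lat_exhaust[of _ m] by metis
  have "x \<in> trunc_lat m (Min (N ` S))" if "x \<in> S" for x
    using N that assms by auto
  then show thesis by (rule that)
qed

section \<open>Lattices\<close>

lemma OK_ideal2: "OK = ideal2 0"
  by (simp add: OK_def ideal2_def)

lemma mult_ideal2: "x \<in> ideal2 p \<Longrightarrow> y \<in> ideal2 q \<Longrightarrow> x * y \<in> ideal2 (p + q)"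
  unfolding ideal2_def using fls_mult_vanish(1)[of p x q y] by auto

lemma subdegree_ideal2: "fls_subdegree x = n \<Longrightarrow> x \<in> ideal2 n"
  by (auto simp: ideal2_def)

lemma inverse_ideal2: "inverse x \<in> ideal2 (- fls_subdegree x)" for x :: "'k::field K2"
  by (rule subdegree_ideal2) (simp add: fls_inverse_subdegree)

text \<open>An \<open>OK\<close>-submodule contains everything of order at least that of one of its
  nonzero elements. Properness bounds these orders below, and the least one is the exponent.\<close>

lemma OK_lattice_iff: "OK_lattice L \<longleftrightarrow> (\<exists>n. L = ideal2 n)"
proof
  assume L: "OK_lattice L"
  then have ks: "kspace L"
    unfolding OK_lattice_def kspace_def by (auto simp: OK_def kc_def)
  have absorb: "x \<in> L" if "l \<in> L" "l \<noteq> 0" "x \<in> ideal2 (fls_subdegree l)" for x l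
  proof -
    have "x * inverse l \<in> OK"
      using mult_ideal2[OF that(3) inverse_ideal2[of l]] by (simp add: OK_ideal2)
    then have "x * inverse l * l \<in> L"
      using L that(1) by (simp add: OK_lattice_def)
    then show ?thesis using that(2) by (simp add: mult.assoc)
  qed
  obtain z where z: "z \<notin> L" using L by (auto simp: OK_lattice_def)
  obtain l0 where l0: "l0 \<in> L" "l0 \<noteq> 0"
    using L by (auto simp: OK_lattice_def)
  have bnd: "fls_subdegree z \<le> fls_subdegree l" if "l \<in> L" "l \<noteq> 0" for l
    using absorb[OF that] z ideal2_mono[of "fls_subdegree l" "fls_subdegree z"]
      subdegree_ideal2[of z, OF refl] by fastforce
  \<comment> \<open>Subtracting the order of \<open>z\<close>, a lower bound, allows minimisation
    over natural numbers.\<close>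
  have "\<exists>l. (l \<in> L \<and> l \<noteq> 0) \<and> (\<forall>l'. l' \<in> L \<and> l' \<noteq> 0 \<longrightarrow>
      nat (fls_subdegree l - fls_subdegree z) \<le> nat (fls_subdegree l' - fls_subdegree z))"
    by (rule ex_has_least_nat) (use l0 in blast)
  then obtain l where l: "l \<in> L" "l \<noteq> 0"
    and "\<forall>l'. l' \<in> L \<and> l' \<noteq> 0 \<longrightarrow>
      nat (fls_subdegree l - fls_subdegree z) \<le> nat (fls_subdegree l' - fls_subdegree z)"
    by blast
  then have min: "fls_subdegree l \<le> fls_subdegree l'" if "l' \<in> L" "l' \<noteq> 0" for l'
    using bnd that l by fastforce
  have "L = ideal2 (fls_subdegree l)"
  proof
    show "L \<subseteq> ideal2 (fls_subdegree l)"
    proof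
      fix x assume "x \<in> L"
      then show "x \<in> ideal2 (fls_subdegree l)"
        using min[of x] by (cases "x = 0") (auto simp: ideal2_def)
    qed
    show "ideal2 (fls_subdegree l) \<subseteq> L"
      using absorb l by blast
  qed
  then show "\<exists>n. L = ideal2 n" ..
next
  assume "\<exists>n. L = ideal2 n"
  then obtain n where L: "L = ideal2 n" ..
  have t: "(fls_X_intpow n :: 'a K2) \<in> L" "(fls_X_intpow n :: 'a K2) \<noteq> 0"
    using intpow2_ideal2 L by auto
  have "(fls_X_intpow (n - 1) :: 'a K2) \<notin> L"
    by (auto simp: L ideal2_def intro!: exI[of _ "n - 1"])
  then have "L \<noteq> UNIV" by blast
  moreover have "L \<noteq> {0}" using t by blast
  moreover have "a * x \<in> L" if "a \<in> OK" "x \<in> L" for a x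
    using mult_ideal2[of a 0 x n] that by (simp add: L OK_ideal2)
  moreover have "\<exists>a l. l \<in> L \<and> x = a * l" for x
    by (rule exI[of _ "x / fls_X_intpow n"], rule exI[of _ "fls_X_intpow n"]) (use t in simp)
  ultimately show "OK_lattice L"
    using kspace_ideal2[of n] unfolding OK_lattice_def kspace_def L by blast
qed

text \<open>Supplies the member of the lattice filtration needed to prove membership in
  \<open>Gr\<close>.\<close>

lemma t1lattice_block:
  assumes "n \<le> m"
  shows "t1lattice (ideal2 m) (ideal2 n) (ideal2 n \<inter> trunc_lat m 0 :: 'k::field K2 set)"
  unfolding t1lattice_def
proof (intro conjI)
  let ?Lam = "ideal2 n \<inter> trunc_lat m 0 :: 'k K2 set"
  show sub: "ideal2 m \<subseteq> ?Lam"
    using ideal2_mono[OF assms] ideal2_trunc_lat by blast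
  show "?Lam \<subseteq> ideal2 n" by blast
  show mod: "t1module ?Lam"
    by (intro t1module_Int t1module_ideal2 t1module_trunc_lat)
  let ?S = "(\<lambda>i. mon i 0) ` {n..<m} :: 'k K2 set"
  have mon: "?S \<subseteq> ?Lam" by (intro image_subsetI mon_block) simp
  have ss: "t1module (ssum (ideal2 m) (t1span ?S))"
    by (intro t1module_ssum t1module_ideal2 t1module_span)
  have "?Lam = ssum (ideal2 m) (t1span ?S)"
  proof
    show "?Lam \<subseteq> ssum (ideal2 m) (t1span ?S)"
    proof (rule block_subset_t1module[OF ss])
      show "ideal2 m \<subseteq> ssum (ideal2 m) (t1span ?S)"
        by (rule ssum_upper1[OF t1module_kspace[OF t1module_span]])
      fix i assume "n \<le> i" "i < m"
      then have "mon i 0 \<in> t1span ?S"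
        by (intro subsetD[OF t1span_superset]) auto
      then show "mon i 0 \<in> ssum (ideal2 m) (t1span ?S)"
        using ssum_upper2[OF kspace_ideal2] by blast
    qed
    show "ssum (ideal2 m) (t1span ?S) \<subseteq> ?Lam"
      by (intro ssum_least sub t1span_minimal mon mod t1module_kspace)
  qed
  then show "\<exists>S. finite S \<and> S \<subseteq> ideal2 n \<and> ?Lam = ssum (ideal2 m) (t1span S)"
    using mon by (intro exI[of _ ?S]) auto
  show "\<forall>x\<in>ideal2 n. \<exists>c lam. lam \<in> ?Lam \<and> x - fls_const c * lam \<in> ideal2 m"
  proof
    fix x :: "'k K2" assume x: "x \<in> ideal2 n"
    obtain N where N: "x \<in> trunc_lat m N" using trunc_lat_exhaust by blast
    \<comment> \<open>Dividing \<open>x\<close> by \<open>t1^N\<close> makes it integral in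
      \<open>t1\<close> below \<open>t2\<close>-degree \<open>m\<close>; multiplying back leaves
      remainder zero.\<close>
    let ?c = "fls_X_intpow N :: 'k fls" and ?c' = "fls_X_intpow (- N) :: 'k fls"
    have "fls_const ?c' * x \<in> ?Lam"
      using x N by (auto simp: ideal2_def trunc_lat_def)
    moreover have "?c * ?c' = 1"
      by (simp only: fls_X_intpow_times_fls_X_intpow) simp
    then have "x - fls_const ?c * (fls_const ?c' * x) = 0"
      by (simp only: mult.assoc [symmetric] fls_const_mult_const) simp
    then have "x - fls_const ?c * (fls_const ?c' * x) \<in> ideal2 m"
      using kspace_zero[OF kspace_ideal2] by metis
    ultimately show "\<exists>c lam. lam \<in> ?Lam \<and> x - fls_const c * lam \<in> ideal2 m" by blast
  qed
qed

text \<open>The last two clauses of \<open>t1lattice\<close> give one bound each: spanning over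
  \<open>k((t1))\<close> puts high powers of \<open>t1\<close> times each \<open>t2^i\<close> into
  \<open>Lam\<close>, and finite generation bounds the poles in \<open>t1\<close>.\<close>

lemma t1lattice_bounds:
  fixes Lam :: "'k::field K2 set"
  assumes Lam: "t1lattice (ideal2 m) (ideal2 n) Lam"
  obtains j j' where "j' \<le> 0" "0 \<le> j" "ideal2 n \<inter> trunc_lat m j \<subseteq> Lam"
    "Lam \<subseteq> ideal2 n \<inter> trunc_lat m j'"
proof -
  have mod: "t1module Lam" and sub: "ideal2 m \<subseteq> Lam" "Lam \<subseteq> ideal2 n"
    and gen: "\<And>x. x \<in> ideal2 n \<Longrightarrow> \<exists>c lam. lam \<in> Lam \<and> x - fls_const c * lam \<in> ideal2 m"
    using Lam by (auto simp: t1lattice_def)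
  have "\<exists>N. \<forall>j\<ge>N. mon i j \<in> Lam" if ni: "n \<le> i" for i
  proof -
    obtain c lam where c: "lam \<in> Lam" "mon i 0 - fls_const c * lam \<in> ideal2 m"
      using gen[OF IntD1[OF mon_block[OF ni, of 0 m]]] by blast
    show ?thesis
    \<comment> \<open>From \<open>t2^i = c * lam\<close> modulo \<open>ideal2 m\<close>: the factor
      \<open>t1^j c\<close> is integral once \<open>j\<close> is at least minus the order of
      \<open>c\<close>.\<close>
    proof (intro exI[of _ "- fls_subdegree c"] allI impI)
      fix j assume "- fls_subdegree c \<le> j"
      then have "fls_X_intpow j * c \<in> kt1"
        by (auto simp: kt1_def)
      then have 1: "fls_const (fls_X_intpow j * c) * lam \<in> Lam"
        using mod c(1) by (simp add: t1module_def)
      have "fls_const (fls_X_intpow j) * (mon i 0 - fls_const c * lam) \<in> ideal2 m"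
        using c(2) by (auto simp: ideal2_def)
      then have 2: "fls_const (fls_X_intpow j) * (mon i 0 - fls_const c * lam) \<in> Lam"
        using sub by blast
      have "mon i j = fls_const (fls_X_intpow j * c) * lam
          + fls_const (fls_X_intpow j) * (mon i 0 - fls_const c * lam)"
        unfolding mon_shift[of i j]
        by (simp only: right_diff_distrib mult.assoc fls_const_mult_const [symmetric]) simp
      then show "mon i j \<in> Lam"
        using kspace_add[OF t1module_kspace[OF mod] 1 2] by simp
    qed
  qed
  then obtain N where N: "\<And>i j. n \<le> i \<Longrightarrow> N i \<le> j \<Longrightarrow> mon i j \<in> Lam" by metis
  define j where "j = Max (insert 0 (N ` {n..<m}))"
  have j: "0 \<le> j" "\<And>i. n \<le> i \<Longrightarrow> i < m \<Longrightarrow> N i \<le> j"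
    unfolding j_def by (rule Max_ge; simp)+
  have lower: "ideal2 n \<inter> trunc_lat m j \<subseteq> Lam"
    by (rule block_subset_t1module[OF mod sub(1)]) (use N j in auto)
  obtain S where S: "finite S" "S \<subseteq> ideal2 n" "Lam = ssum (ideal2 m) (t1span S)"
    using Lam by (auto simp: t1lattice_def)
  obtain j0 where "\<And>x. x \<in> S \<Longrightarrow> x \<in> trunc_lat m j0"
    using trunc_lat_exhaust_finite[OF S(1)] by blast
  then have "S \<subseteq> trunc_lat m (min j0 0)"
    using trunc_lat_mono[of "min j0 0" j0 m] by auto
  then have "Lam \<subseteq> trunc_lat m (min j0 0)"
    unfolding S(3)
    by (intro ssum_least ideal2_trunc_lat t1span_minimal t1module_trunc_lat kspace_trunc_lat)
  then show thesis
    using that[of "min j0 0" j] j lower sub by auto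
qed

section \<open>Multiplication by a nonzero element\<close>

lemma mulset_mem: "h \<noteq> 0 \<Longrightarrow> x \<in> mulset h A \<longleftrightarrow> inverse h * x \<in> A" for h :: "'k::field K2"
  by (auto simp: mulset_def image_iff mult.assoc [symmetric] intro!: bexI[of _ "inverse h * x"])

lemma mulset_memI: "x \<in> A \<Longrightarrow> h * x \<in> mulset h A"
  by (simp add: mulset_def imageI)

lemma mulset_mulset: "mulset g (mulset h A) = mulset (g * h) A"
  by (simp add: mulset_def image_image mult.assoc)

lemma mulset_one: "mulset 1 A = A"
  by (simp add: mulset_def)

lemma mulset_inverse [simp]:
  "h \<noteq> 0 \<Longrightarrow> mulset (inverse h) (mulset h A) = A" "h \<noteq> 0 \<Longrightarrow> mulset h (mulset (inverse h) A) = A"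
  by (simp_all add: mulset_mulset mulset_one)

lemma mulset_mono: "A \<subseteq> B \<Longrightarrow> mulset h A \<subseteq> mulset h B"
  by (auto simp: mulset_def)

lemma mulset_subset_iff: "h \<noteq> 0 \<Longrightarrow> mulset h A \<subseteq> mulset h B \<longleftrightarrow> A \<subseteq> B"
  by (metis mulset_inverse(1) mulset_mono)

lemma mulset_Int: "h \<noteq> 0 \<Longrightarrow> mulset h (A \<inter> B) = mulset h A \<inter> mulset h B"
  by (auto simp: mulset_mem)

lemma mulset_ssum: "mulset h (ssum A B) = ssum (mulset h A) (mulset h B)"
proof (intro set_eqI iffI)
  fix x assume "x \<in> mulset h (ssum A B)"
  then obtain a b where "a \<in> A" "b \<in> B" "x = h * a + h * b"
    by (auto simp: mulset_def ssum_def distrib_left)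
  then show "x \<in> ssum (mulset h A) (mulset h B)"
    by (auto intro: ssumI mulset_memI)
next
  fix x assume "x \<in> ssum (mulset h A) (mulset h B)"
  then obtain a b where "a \<in> A" "b \<in> B" "x = h * (a + b)"
    by (auto simp: mulset_def ssum_def distrib_left)
  then show "x \<in> mulset h (ssum A B)"
    by (auto intro: ssumI mulset_memI)
qed

lemma kspace_mulset: "kspace A \<Longrightarrow> kspace (mulset h A)"
  unfolding kspace_def mulset_def
  by (auto simp: image_iff distrib_left [symmetric] mult.left_commute[of _ h])

lemma kspan_mulset:
  assumes "h \<noteq> 0"
  shows "kspan (mulset h S) = mulset h (kspan S)"
proof
  show "kspan (mulset h S) \<subseteq> mulset h (kspan S)"
    by (intro kspan_minimal mulset_mono kspan_superset kspace_mulset kspace_kspan)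
  have "mulset (inverse h) (mulset h S) \<subseteq> mulset (inverse h) (kspan (mulset h S))"
    by (intro mulset_mono kspan_superset)
  then have "kspan S \<subseteq> mulset (inverse h) (kspan (mulset h S))"
    using assms by (intro kspan_minimal kspace_mulset kspace_kspan) simp
  then show "mulset h (kspan S) \<subseteq> kspan (mulset h S)"
    using mulset_mono[of "kspan S" "mulset (inverse h) (kspan (mulset h S))" h] assms by simp
qed

lemma spanning_mulset:
  assumes h: "h \<noteq> 0" and S: "finite S" "S \<subseteq> X" "X \<subseteq> ssum Y (kspan S)"
  shows "finite (mulset h S)" "mulset h S \<subseteq> mulset h X"
    "mulset h X \<subseteq> ssum (mulset h Y) (kspan (mulset h S))" "card (mulset h S) = card S"
proof -
  show "finite (mulset h S)"
    using S by (simp add: mulset_def)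
  show "mulset h S \<subseteq> mulset h X" "mulset h X \<subseteq> ssum (mulset h Y) (kspan (mulset h S))"
    using S h by (auto simp: kspan_mulset mulset_subset_iff simp flip: mulset_ssum)
  show "card (mulset h S) = card S"
    unfolding mulset_def by (intro card_image inj_onI) (use h in simp)
qed

lemma spanning_mulset_iff:
  assumes h: "h \<noteq> 0"
  shows "(\<exists>S. finite S \<and> S \<subseteq> mulset h X \<and> card S = n \<and> mulset h X \<subseteq> ssum (mulset h Y) (kspan S))
    \<longleftrightarrow> (\<exists>S. finite S \<and> S \<subseteq> X \<and> card S = n \<and> X \<subseteq> ssum Y (kspan S))" (is "?L \<longleftrightarrow> ?R")
proof
  assume ?L
  then obtain S where S: "finite S" "S \<subseteq> mulset h X" "card S = n"
    "mulset h X \<subseteq> ssum (mulset h Y) (kspan S)" by blast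
  have "inverse h \<noteq> 0" using h by simp
  from spanning_mulset[OF this S(1,2,4)] S(3) h show ?R
    by (intro exI[of _ "mulset (inverse h) S"]) simp
next
  assume ?R
  then obtain S where S: "finite S" "S \<subseteq> X" "card S = n" "X \<subseteq> ssum Y (kspan S)" by blast
  from spanning_mulset[OF h S(1,2,4)] S(3) show ?L
    by (intro exI[of _ "mulset h S"]) simp
qed

lemma qdim_mulset: "h \<noteq> 0 \<Longrightarrow> qdim (mulset h X) (mulset h Y) = qdim X Y"
  by (simp add: qdim_def spanning_mulset_iff)

lemma qfin_mulset:
  assumes "h \<noteq> 0"
  shows "qfin (mulset h X) (mulset h Y) \<longleftrightarrow> qfin X Y"
proof -
  have *: "qfin X Y \<longleftrightarrow> (\<exists>n S. finite S \<and> S \<subseteq> X \<and> card S = n \<and> X \<subseteq> ssum Y (kspan S))"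
    for X Y :: "'a K2 set"
    by (auto simp: qfin_def)
  then show ?thesis
    by (simp only: * spanning_mulset_iff[OF assms])
qed

lemma commens_mulset: "h \<noteq> 0 \<Longrightarrow> commens (mulset h U) (mulset h V) \<longleftrightarrow> commens U V"
  by (simp add: commens_def qfin_mulset flip: mulset_Int)

lemma relidx_mulset: "h \<noteq> 0 \<Longrightarrow> relidx (mulset h U) (mulset h V) = relidx U V"
  by (simp add: relidx_def qdim_mulset flip: mulset_Int)

lemma nu2_inverse: "nu2 (inverse h) = - nu2 h" for h :: "'k::field K2"
  by (simp add: nu2_def fls_inverse_subdegree)

lemma mulset_subset_via_inverse:
  assumes "h \<noteq> 0" "mulset (inverse h) B \<subseteq> A"
  shows "B \<subseteq> mulset h A"
  using mulset_mono[OF assms(2), of h] assms(1) by simp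

lemma mulset_ideal2:
  assumes h: "h \<noteq> (0 :: 'k::field K2)"
  shows "mulset h (ideal2 n) = ideal2 (n + nu2 h)"
proof -
  have le: "mulset g (ideal2 n) \<subseteq> ideal2 (n + nu2 g)" for g :: "'k K2" and n
    using mult_ideal2[OF subdegree_ideal2[of g, OF refl], of _ n]
    by (auto simp: mulset_def nu2_def add.commute)
  have "ideal2 (n + nu2 h) \<subseteq> mulset h (ideal2 n)"
    using mulset_subset_via_inverse[OF h] le[of "inverse h" "n + nu2 h"] by (simp add: nu2_inverse)
  with le show ?thesis by blast
qed

text \<open>The loss of \<open>t1\<close>-order is uniform in \<open>j\<close>, because only the
  finitely many \<open>t2^i\<close> with \<open>n \<le> i < m\<close> need testing and
  \<open>h\<close> commutes with powers of \<open>t1\<close>.\<close>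

lemma mulset_block:
  fixes h :: "'k::field K2"
  assumes h: "h \<noteq> 0"
  obtains N where "\<And>j. mulset h (ideal2 n \<inter> trunc_lat m j)
    \<subseteq> ideal2 (n + nu2 h) \<inter> trunc_lat (m + nu2 h) (j + N)"
proof -
  obtain N where N: "\<And>x. x \<in> (\<lambda>i. h * mon i 0) ` {n..<m} \<Longrightarrow> x \<in> trunc_lat (m + nu2 h) N"
    using trunc_lat_exhaust_finite[of "(\<lambda>i. h * mon i 0) ` {n..<m}"] by blast
  have "mulset h (ideal2 n \<inter> trunc_lat m j) \<subseteq> ideal2 (n + nu2 h) \<inter> trunc_lat (m + nu2 h) (j + N)" for j
  proof -
    \<comment> \<open>This preimage is a \<open>k[[t1]]\<close>-module, so the inclusion reduces to
      monomials.\<close>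
    define W where "W = {x. h * x \<in> trunc_lat (m + nu2 h) (j + N)}"
    have mod: "t1module W"
      using t1module_trunc_lat[of "m + nu2 h" "j + N"]
      by (auto simp: W_def t1module_def distrib_left mult.left_commute[of h])
    have "ideal2 m \<subseteq> W"
      using mulset_ideal2[OF h, of m] ideal2_trunc_lat[of "m + nu2 h" "j + N"]
      by (auto simp: W_def mulset_def)
    moreover have "mon i j \<in> W" if "n \<le> i" "i < m" for i
    proof -
      have "h * mon i 0 \<in> trunc_lat (m + nu2 h) N"
        by (rule N) (use that in auto)
      then have "fls_const (fls_X_intpow j) * (h * mon i 0) \<in> trunc_lat (m + nu2 h) (j + N)"
        by (auto simp: trunc_lat_def)
      then show ?thesis
        unfolding W_def mon_shift[of i j] by (simp add: mult.left_commute)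
    qed
    ultimately have "ideal2 n \<inter> trunc_lat m j \<subseteq> W"
      by (intro block_subset_t1module mod)
    then show ?thesis
      using mulset_ideal2[OF h, of n] by (auto simp: W_def mulset_def)
  qed
  then show thesis by (rule that)
qed

section \<open>Dimension theories relative to the integral structure\<close>

text \<open>These are exactly the subspaces \<open>approx\<close> to \<open>OK\<close>.\<close>

definition sandwiched :: "'k::field K2 set \<Rightarrow> bool" where
  "sandwiched A \<longleftrightarrow> kspace A \<and> (\<exists>n m. ideal2 m \<subseteq> A \<and> A \<subseteq> ideal2 n)"

definition sandwiched_pair :: "'k::field K2 set \<Rightarrow> 'k K2 set \<Rightarrow> bool" where
  "sandwiched_pair A C \<longleftrightarrow> sandwiched A \<and> sandwiched C \<and> C \<subseteq> A"

definition integral_part :: "'k::field K2 set \<Rightarrow> 'k K2 set \<Rightarrow> 'k K2 set" where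
  "integral_part A C = ssum (EK \<inter> A) C"

text \<open>A coordinate on \<open>Dim A C\<close>: \<open>n\<close> is the value at the base point
  \<open>integral_part A C\<close>, and 0 off \<open>Gr\<close> is the default imposed by
  \<open>Dim\<close>.\<close>

definition dimth :: "'k::field K2 set \<Rightarrow> 'k K2 set \<Rightarrow> int \<Rightarrow> 'k dimth" where
  "dimth A C n = (\<lambda>U. if U \<in> Gr A C then relidx (integral_part A C) U + n else 0)"

definition thom :: "'k::field K2 set \<Rightarrow> 'k K2 set \<Rightarrow> 'k K2 set \<Rightarrow> int \<Rightarrow> 'k thom" where
  "thom A B C n = (\<lambda>x\<in>Dim A C. dimth B C (x (integral_part A C) + n))"

lemma sandwiched_pairD:
  assumes "sandwiched_pair A C"
  shows "kspace A" "kspace C" "C \<subseteq> A" "sandwiched A" "sandwiched C" "\<exists>m. ideal2 m \<subseteq> C" "\<exists>n. A \<subseteq> ideal2 n"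
  using assms by (auto simp: sandwiched_pair_def sandwiched_def)

lemma sandwiched_pair_bounds:
  fixes A :: "'k::field K2 set"
  assumes "sandwiched_pair A C"
  obtains n m where "n \<le> m" "ideal2 m \<subseteq> C" "C \<subseteq> A" "A \<subseteq> ideal2 n"
proof -
  obtain n m where nm: "ideal2 m \<subseteq> C" "C \<subseteq> A" "A \<subseteq> ideal2 n"
    using sandwiched_pairD[OF assms] by blast
  then have "(ideal2 m :: 'k K2 set) \<subseteq> ideal2 n" by blast
  then show thesis using nm that ideal2_subset_iff by blast
qed

lemma sandwiched_pair_trans: "sandwiched_pair A C \<Longrightarrow> sandwiched_pair C D \<Longrightarrow> sandwiched_pair A D"
  by (auto simp: sandwiched_pair_def)

lemma sandwiched_ideal2: "sandwiched (ideal2 n)"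
  by (auto simp: sandwiched_def kspace_ideal2)

lemma sandwiched_Int: "sandwiched A \<Longrightarrow> sandwiched B \<Longrightarrow> sandwiched (A \<inter> B)"
proof -
  assume "sandwiched A" "sandwiched B"
  then obtain m m' n where *: "kspace A" "kspace B" "ideal2 m \<subseteq> A" "ideal2 m' \<subseteq> B" "A \<subseteq> ideal2 n"
    by (auto simp: sandwiched_def)
  then have "ideal2 (max m m') \<subseteq> A \<inter> B"
    using ideal2_mono[of m "max m m'"] ideal2_mono[of m' "max m m'"] by auto
  moreover have "A \<inter> B \<subseteq> ideal2 n"
    using * by blast
  ultimately show ?thesis
    using * unfolding sandwiched_def by (blast intro: kspace_Int)
qed

lemma kspace_integral_part: "kspace A \<Longrightarrow> kspace C \<Longrightarrow> kspace (integral_part A C)"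
  by (simp add: integral_part_def kspace_ssum kspace_Int kspace_EK)

lemma integral_part_bounds:
  assumes "kspace A" "kspace C" "C \<subseteq> A"
  shows "C \<subseteq> integral_part A C" "integral_part A C \<subseteq> A"
  using assms ssum_upper2[OF kspace_Int[OF kspace_EK]] ssum_least[of "EK \<inter> A" A C]
  by (auto simp: integral_part_def)

lemma integral_part_refl: "kspace A \<Longrightarrow> integral_part A A = A"
  using integral_part_bounds[of A A] by auto

lemma integral_part_Int:
  assumes "kspace C" "D \<subseteq> C" "C \<subseteq> A"
  shows "integral_part A D \<inter> C = integral_part C D"
proof -
  have "integral_part A D \<inter> C = ssum D (EK \<inter> A) \<inter> C"
    by (simp add: integral_part_def ssum_commute)
  also have "\<dots> = ssum D (EK \<inter> A \<inter> C)"
    by (rule ssum_modular[OF assms(1,2)])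
  also have "\<dots> = integral_part C D"
    using assms(3) by (simp add: integral_part_def ssum_commute Int_assoc Int_absorb1)
  finally show ?thesis .
qed

lemma integral_part_ssum:
  assumes "kspace C" "kspace D" "D \<subseteq> C"
  shows "ssum (integral_part A D) C = integral_part A C"
  unfolding integral_part_def using ssum_absorb[OF assms] by (simp add: ssum_assoc ssum_commute[of D C])

text \<open>Modulo \<open>C\<close>, integrality matters only in \<open>t2\<close>-degrees below
  \<open>m\<close>. This links \<open>EK\<close> to the lattices occurring in
  \<open>Gr\<close>.\<close>

lemma integral_part_trunc_lat:
  fixes A :: "'k::field K2 set"
  assumes "kspace A" "kspace C" "ideal2 m \<subseteq> C" "C \<subseteq> A"
  shows "integral_part A C = ssum (trunc_lat m 0 \<inter> A) C"
proof
  show "integral_part A C \<subseteq> ssum (trunc_lat m 0 \<inter> A) C"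
    unfolding integral_part_def by (rule ssum_mono) (auto simp: EK_def trunc_lat_def)
  have "x \<in> integral_part A C" if x: "x \<in> trunc_lat m 0" "x \<in> A" for x
  proof -
    \<comment> \<open>The part of \<open>x\<close> of \<open>t2\<close>-degree at least
      \<open>m\<close>: it lies in \<open>C\<close>, and removing it leaves an element of
      \<open>EK\<close>.\<close>
    define y where "y = fls_shift (- m) (fps_to_fls (fls_regpart (fls_shift m x)))"
    have y: "y $$ i = (if i < m then 0 else x $$ i)" for i
      by (simp add: y_def)
    have "y \<in> C"
      using assms(3) by (auto simp: ideal2_def y)
    moreover from this have "x - y \<in> A"
      using assms(4) x(2) by (auto intro: kspace_diff[OF assms(1)])
    moreover have "x - y \<in> EK"
      using x(1) by (auto simp: EK_def trunc_lat_def y)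
    ultimately show ?thesis
      using ssumI[of "x - y" "EK \<inter> A" y C] by (simp add: integral_part_def)
  qed
  then show "ssum (trunc_lat m 0 \<inter> A) C \<subseteq> integral_part A C"
    using assms by (intro ssum_least kspace_integral_part integral_part_bounds) auto
qed

text \<open>Stated for bounds by blocks rather than for lattices, so that it also covers images of
  blocks under multiplication.\<close>

lemma commens_integral_part:
  assumes k: "kspace A" "kspace C" "kspace Lam" and sub: "ideal2 m \<subseteq> C" "C \<subseteq> A" "A \<subseteq> ideal2 n"
    and Lam: "ideal2 n \<inter> trunc_lat m j \<subseteq> Lam" "Lam \<subseteq> ideal2 n \<inter> trunc_lat m j'"
  shows "commens (ssum (Lam \<inter> A) C) (integral_part A C)"
proof -
  let ?T = "\<lambda>j. ideal2 n \<inter> trunc_lat m j"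
  \<comment> \<open>Widening the window to contain exponent 0 puts \<open>Lam\<close> and the
    integral block between the same two blocks.\<close>
  let ?lo = "max j 0" and ?hi = "min j' 0"
  have mono: "?T j1 \<subseteq> ?T j2" if "j2 \<le> j1" for j1 j2
    using trunc_lat_mono[OF that] by auto
  have Lam': "?T ?lo \<subseteq> Lam" "Lam \<subseteq> ?T ?hi"
    using Lam mono[of j ?lo] mono[of ?hi j'] by auto
  have q: "qfin Lam (?T ?lo)"
    by (rule qfin_mono[OF _ _ _ _ _ Lam' qfin_block]) (auto intro: k kspace_block)
  have "commens Lam (?T 0)"
    by (rule commensI[OF k(3) _ _ Lam'(1) mono q qfin_block]) (auto intro: kspace_block)
  then have "commens (Lam \<inter> A) (?T 0 \<inter> A)"
    by (rule commens_Int[OF k(3) kspace_block k(1)])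
  then have "commens (ssum (Lam \<inter> A) C) (ssum (?T 0 \<inter> A) C)"
    by (intro commens_ssum kspace_Int kspace_ideal2 kspace_trunc_lat k)
  moreover have "?T 0 \<inter> A = trunc_lat m 0 \<inter> A"
    using sub by auto
  ultimately show ?thesis
    using integral_part_trunc_lat[OF k(1,2) sub(1,2)] by simp
qed

text \<open>Every lattice of the filtration yields a subspace commensurable with the base point, so
  the existential over lattices collapses to one condition.\<close>

lemma Gr_iff:
  fixes A :: "'k::field K2 set"
  assumes AC: "sandwiched_pair A C"
  shows "U \<in> Gr A C \<longleftrightarrow> kspace U \<and> C \<subseteq> U \<and> U \<subseteq> A \<and> commens U (integral_part A C)"
proof
  note k = sandwiched_pairD(1,2,3)[OF AC]
  {
    assume "U \<in> Gr A C"
    then obtain L M Lam where U: "kspace U" "C \<subseteq> U" "U \<subseteq> A" and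
      L: "OK_lattice L" "OK_lattice M" "L \<subseteq> C" "A \<subseteq> M" "t1lattice L M Lam"
      "commens U (ssum (Lam \<inter> A) C)"
      by (auto simp: Gr_def)
    then obtain m n where mn: "L = ideal2 m" "M = ideal2 n"
      by (auto simp: OK_lattice_iff)
    obtain j j' where j: "ideal2 n \<inter> trunc_lat m j \<subseteq> Lam" "Lam \<subseteq> ideal2 n \<inter> trunc_lat m j'"
      using t1lattice_bounds L(5) mn by metis
    have kL: "kspace Lam"
      using L(5) by (auto simp: t1lattice_def intro: t1module_kspace)
    have "commens (ssum (Lam \<inter> A) C) (integral_part A C)"
      by (rule commens_integral_part[OF k(1,2) kL _ k(3) _ j]) (use L mn in auto)
    then have "commens U (integral_part A C)"
      by (rule commens_trans[OF U(1) kspace_ssum[OF kspace_Int[OF kL k(1)] k(2)]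
            kspace_integral_part[OF k(1,2)] L(6)])
    with U show "kspace U \<and> C \<subseteq> U \<and> U \<subseteq> A \<and> commens U (integral_part A C)" by blast
  }
  assume U: "kspace U \<and> C \<subseteq> U \<and> U \<subseteq> A \<and> commens U (integral_part A C)"
  obtain n m where nm: "n \<le> m" "ideal2 m \<subseteq> C" "A \<subseteq> ideal2 n"
    using sandwiched_pair_bounds[OF AC] by metis
  let ?Lam = "ideal2 n \<inter> trunc_lat m 0"
  have "commens (ssum (?Lam \<inter> A) C) (integral_part A C)"
    by (rule commens_integral_part[OF k(1,2) kspace_block nm(2) k(3) nm(3)]) auto
  then have "commens (integral_part A C) (ssum (?Lam \<inter> A) C)"
    by (rule commens_sym)
  then have "commens U (ssum (?Lam \<inter> A) C)"
    by (rule commens_trans[OF conjunct1[OF U] kspace_integral_part[OF k(1,2)]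
          kspace_ssum[OF kspace_Int[OF kspace_block k(1)] k(2)], rotated]) (use U in blast)
  moreover have "OK_lattice (ideal2 m :: 'k K2 set) \<and> OK_lattice (ideal2 n :: 'k K2 set)"
    by (auto simp: OK_lattice_iff)
  ultimately have "\<exists>L M Lam. OK_lattice L \<and> OK_lattice M \<and> L \<subseteq> M \<and> L \<subseteq> C \<and> A \<subseteq> M \<and>
      t1lattice L M Lam \<and> commens U (ssum (Lam \<inter> A) C)"
    using nm(2,3) t1lattice_block[OF nm(1)] ideal2_mono[OF nm(1)] by metis
  then show "U \<in> Gr A C"
    using U by (simp only: Gr_def mem_Collect_eq simp_thms)
qed

lemma integral_part_mem_Gr: "sandwiched_pair A C \<Longrightarrow> integral_part A C \<in> Gr A C"
  using sandwiched_pairD(1-3)[of A C] by (simp add: Gr_iff kspace_integral_part integral_part_bounds commens_refl)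

lemma dimth_integral_part: "sandwiched_pair A C \<Longrightarrow> dimth A C n (integral_part A C) = n"
  by (simp add: dimth_def integral_part_mem_Gr relidx_refl)

section \<open>Integer coordinates on dimension theories and their homomorphisms\<close>

lemma relidx_integral_part_cocycle:
  assumes AC: "sandwiched_pair A C" and U: "U \<in> Gr A C" and V: "V \<in> Gr A C"
  shows "relidx (integral_part A C) V = relidx (integral_part A C) U + relidx U V"
proof (rule relidx_cocycle)
  show "kspace (integral_part A C)" "kspace U" "kspace V" "commens (integral_part A C) U"
    using U V sandwiched_pairD[OF AC] by (auto simp: Gr_iff[OF AC] kspace_integral_part intro: commens_sym)
  show "commens U V"
    using U V sandwiched_pairD[OF AC]
    by (intro commens_trans[of U "integral_part A C" V]) (auto simp: Gr_iff[OF AC] kspace_integral_part intro: commens_sym)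
qed

lemma Dim_eq:
  assumes AC: "sandwiched_pair A C"
  shows "Dim A C = range (dimth A C)"
proof
  show "range (dimth A C) \<subseteq> Dim A C"
  proof
    fix d assume "d \<in> range (dimth A C)"
    then obtain n where d: "d = dimth A C n" by blast
    have "d V = d U + relidx U V" if "U \<in> Gr A C" "V \<in> Gr A C" for U V
      using relidx_integral_part_cocycle[OF AC that] that by (simp add: d dimth_def)
    moreover have "d U = 0" if "U \<notin> Gr A C" for U
      using that by (simp add: d dimth_def)
    ultimately show "d \<in> Dim A C"
      unfolding Dim_def by blast
  qed
  show "Dim A C \<subseteq> range (dimth A C)"
  proof
    fix d assume d: "d \<in> Dim A C"
    have "d U = d (integral_part A C) + relidx (integral_part A C) U" if "U \<in> Gr A C" for U
      using d integral_part_mem_Gr[OF AC] that unfolding Dim_def by blast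
    moreover have "d U = 0" if "U \<notin> Gr A C" for U
      using d that unfolding Dim_def by blast
    ultimately have "d = dimth A C (d (integral_part A C))"
      by (intro ext) (simp add: dimth_def)
    then show "d \<in> range (dimth A C)" by blast
  qed
qed

lemma dimth_inject: "sandwiched_pair A C \<Longrightarrow> dimth A C m = dimth A C n \<longleftrightarrow> m = n"
  by (metis dimth_integral_part)

lemma dadd_dimth: "dadd (Gr A C) (dimth A C m) n = dimth A C (m + n)"
  by (auto simp: dadd_def dimth_def)

lemma thom_dimth: "sandwiched_pair A C \<Longrightarrow> thom A B C n (dimth A C m) = dimth B C (m + n)"
  by (simp add: thom_def Dim_eq dimth_integral_part)

lemma thom_eqI:
  assumes "sandwiched_pair A C" "\<phi> \<in> extensional (Dim A C)"
    and "\<And>m. \<phi> (dimth A C m) = dimth B C (m + n)"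
  shows "\<phi> = thom A B C n"
proof (rule extensionalityI)
  show "thom A B C n \<in> extensional (Dim A C)" by (simp add: thom_def)
  show "\<phi> x = thom A B C n x" if "x \<in> Dim A C" for x
    using that assms by (auto simp: Dim_eq thom_dimth)
qed (rule assms)

lemma thom_inject:
  assumes "sandwiched_pair A C" "sandwiched_pair B C"
  shows "thom A B C m = thom A B C n \<longleftrightarrow> m = n"
  using thom_dimth[OF assms(1), of B _ 0] dimth_inject[OF assms(2)] by (metis add_0)

text \<open>Equivariance under \<open>dadd\<close> forces a translation, read off from the image of
  \<open>dimth A C 0\<close>.\<close>

lemma TorHom_eq:
  assumes AC: "sandwiched_pair A C" and BC: "sandwiched_pair B C"
  shows "TorHom A B C = range (thom A B C)"
proof
  show "range (thom A B C) \<subseteq> TorHom A B C"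
  proof
    fix \<phi> assume "\<phi> \<in> range (thom A B C)"
    then obtain n where n: "\<phi> = thom A B C n" by blast
    have "\<phi> \<in> Dim A C \<rightarrow>\<^sub>E Dim B C"
      using BC unfolding n thom_def by (auto simp: Dim_eq)
    then show "\<phi> \<in> TorHom A B C"
      unfolding n TorHom_def Dim_eq[OF AC] by (auto simp: dadd_dimth thom_dimth[OF AC] add.commute add.left_commute)
  qed
  show "TorHom A B C \<subseteq> range (thom A B C)"
  proof
    fix \<phi> assume \<phi>: "\<phi> \<in> TorHom A B C"
    have "\<phi> (dimth A C 0) \<in> Dim B C"
      using \<phi> by (auto simp: TorHom_def Dim_eq[OF AC])
    then obtain n where n: "\<phi> (dimth A C 0) = dimth B C n"
      by (auto simp: Dim_eq[OF BC])
    have "\<phi> (dimth A C m) = dimth B C (m + n)" for m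
    proof -
      have "\<phi> (dadd (Gr A C) (dimth A C 0) m) = dadd (Gr B C) (\<phi> (dimth A C 0)) m"
        using \<phi> by (auto simp: TorHom_def Dim_eq[OF AC])
      then show ?thesis by (simp add: n dadd_dimth add.commute)
    qed
    then have "\<phi> = thom A B C n"
      using \<phi> by (intro thom_eqI AC) (auto simp: TorHom_def PiE_def)
    then show "\<phi> \<in> range (thom A B C)" by blast
  qed
qed

text \<open>The base point of \<open>A/D\<close> meets \<open>C\<close> in that of
  \<open>C/D\<close> and projects to that of \<open>A/C\<close>; since \<open>relidx\<close> splits
  the same way, gluing adds coordinates.\<close>

lemma glue_dimth:
  assumes AC: "sandwiched_pair A C" and CD: "sandwiched_pair C D"
  shows "glue A C D (dimth C D i) (dimth A C j) = dimth A D (i + j)"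
proof -
  note AD = sandwiched_pair_trans[OF AC CD]
  note k = sandwiched_pairD(1-3)[OF AC] sandwiched_pairD(2,3)[OF CD]
  have "glue A C D (dimth C D i) (dimth A C j) U = dimth A D (i + j) U" for U
  proof (cases "U \<in> Gr A D")
    case True
    then have U: "kspace U" "D \<subseteq> U" "U \<subseteq> A" "commens (integral_part A D) U"
      by (auto simp: Gr_iff[OF AD] intro: commens_sym)
    note kb = kspace_integral_part[OF k(1,4)]
    note b = integral_part_Int[OF k(2,5,3)] integral_part_ssum[OF k(2,4,5), of A]
    note c = commens_Int[OF kb U(1) k(2) U(4)] commens_ssum[OF kb U(1) k(2) U(4)]
      relidx_split[OF kb U(1) k(2) U(4)]
    have "U \<inter> C \<in> Gr C D"
      using U k c(1) unfolding Gr_iff[OF CD] b by (auto intro: kspace_Int commens_sym)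
    moreover have "ssum U C \<in> Gr A C"
      using U k c(2) ssum_upper2[OF U(1), of C] ssum_least[OF U(3) k(3,1)] unfolding Gr_iff[OF AC] b
      by (auto intro: kspace_ssum commens_sym)
    ultimately show ?thesis
      using True c(3) unfolding b by (simp add: glue_def dimth_def)
  qed (simp add: glue_def dimth_def)
  then show ?thesis by blast
qed

text \<open>The decomposition picked by \<open>SOME\<close> is not unique, but only the sum of its
  coordinates enters the result.\<close>

lemma trans_thom:
  assumes AC: "sandwiched_pair A C" and BC: "sandwiched_pair B C" and CD: "sandwiched_pair C D"
  shows "trans A B C D (thom A B C n) = thom A B D n"
proof (rule thom_eqI)
  show AD: "sandwiched_pair A D" by (rule sandwiched_pair_trans[OF AC CD])
  show "trans A B C D (thom A B C n) \<in> extensional (Dim A D)"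
    by (simp add: trans_def)
  fix m
  let ?P = "\<lambda>p. fst p \<in> Dim C D \<and> snd p \<in> Dim A C \<and> glue A C D (fst p) (snd p) = dimth A D m"
  have "?P (dimth C D 0, dimth A C m)"
    by (simp add: Dim_eq[OF AC] Dim_eq[OF CD] glue_dimth[OF AC CD])
  then have "?P (SOME p. ?P p)" by (rule someI[of ?P])
  moreover obtain e x where ex: "(SOME p. ?P p) = (e, x)" by fastforce
  ultimately have P: "e \<in> Dim C D" "x \<in> Dim A C" "glue A C D e x = dimth A D m" by simp_all
  obtain i j where ij: "e = dimth C D i" "x = dimth A C j"
    using P(1,2) by (auto simp: Dim_eq[OF AC] Dim_eq[OF CD])
  have "i + j = m"
    using P(3) dimth_inject[OF AD] by (simp add: ij glue_dimth[OF AC CD])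
  have "trans A B C D (thom A B C n) (dimth A D m) = glue B C D e (thom A B C n x)"
    using ex by (simp add: trans_def Dim_eq[OF AD])
  also have "\<dots> = dimth B D (i + (j + n))"
    by (simp add: ij thom_dimth[OF AC] glue_dimth[OF BC CD])
  finally show "trans A B C D (thom A B C n) (dimth A D m) = dimth B D (m + n)"
    by (simp flip: \<open>i + j = m\<close> add: add.assoc)
qed

section \<open>The direct limit\<close>

text \<open>Translations by the same \<open>n\<close> over all admissible \<open>C\<close> form one
  whole equivalence class, that is, one element of the direct limit.\<close>

definition tcls :: "'k::field K2 set \<Rightarrow> 'k K2 set \<Rightarrow> int \<Rightarrow> ('k K2 set \<times> 'k thom) set" where
  "tcls A B n = (\<lambda>C. (C, thom A B C n)) ` Idx A B"

lemma Idx_iff: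
  fixes A B :: "'k::field K2 set"
  assumes "sandwiched A" "sandwiched B"
  shows "C \<in> Idx A B \<longleftrightarrow> sandwiched_pair A C \<and> sandwiched_pair B C"
proof
  assume "C \<in> Idx A B"
  then have C: "kspace C" "C \<subseteq> A" "C \<subseteq> B" "approx C A" by (auto simp: Idx_def)
  then obtain m n where "ideal2 m \<subseteq> C" "C \<subseteq> ideal2 n"
    by (auto simp: approx_def OK_lattice_iff)
  then show "sandwiched_pair A C \<and> sandwiched_pair B C"
    using C assms by (auto simp: sandwiched_pair_def sandwiched_def)
next
  assume C: "sandwiched_pair A C \<and> sandwiched_pair B C"
  then obtain n m where "n \<le> m" "ideal2 m \<subseteq> C" "C \<subseteq> A" "A \<subseteq> ideal2 n"
    using sandwiched_pair_bounds by metis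
  moreover have "OK_lattice (ideal2 m :: 'k K2 set)" "OK_lattice (ideal2 n :: 'k K2 set)" for m n
    by (auto simp: OK_lattice_iff)
  moreover have "kspace A" "kspace C"
    using C sandwiched_pairD(1,2) by blast+
  ultimately have "approx C A"
    unfolding approx_def by (meson order.refl order.trans)
  then show "C \<in> Idx A B"
    using C sandwiched_pairD[of A C] sandwiched_pairD[of B C] by (auto simp: Idx_def)
qed

lemma sandwiched_pair_Int: "sandwiched_pair A C \<Longrightarrow> sandwiched D \<Longrightarrow> sandwiched_pair A (C \<inter> D)"
  by (auto simp: sandwiched_pair_def sandwiched_Int)

lemma Idx_nonempty: "sandwiched A \<Longrightarrow> sandwiched B \<Longrightarrow> A \<inter> B \<in> Idx A B"
  by (auto simp: Idx_iff sandwiched_pair_def sandwiched_Int)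

lemma Rep_eq:
  assumes "sandwiched A" "sandwiched B"
  shows "Rep A B = (\<Union>n. tcls A B n)"
  using assms by (auto simp: Rep_def tcls_def Idx_iff TorHom_eq image_iff)

text \<open>Transitions keep the label, and over a fixed index distinct labels give distinct maps;
  \<open>C \<inter> D\<close> is a common refinement.\<close>

lemma eqv_thom:
  assumes A: "sandwiched A" and B: "sandwiched B" and C: "C \<in> Idx A B" and D: "D \<in> Idx A B"
  shows "eqv A B (C, thom A B C m) (D, thom A B D n) \<longleftrightarrow> m = n"
proof -
  have tr: "trans A B C' E (thom A B C' k) = thom A B E k"
    if "C' \<in> Idx A B" "E \<in> Idx A B" "E \<subseteq> C'" for C' E k
    using that by (intro trans_thom) (auto simp: Idx_iff[OF A B] sandwiched_pair_def)
  have inj: "thom A B E m = thom A B E n \<longleftrightarrow> m = n" if "E \<in> Idx A B" for E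
    using that by (intro thom_inject) (auto simp: Idx_iff[OF A B])
  have CD: "C \<inter> D \<in> Idx A B"
    using C D by (auto simp: Idx_iff[OF A B] intro!: sandwiched_pair_Int dest: sandwiched_pairD(5))
  have R: "(C, thom A B C m) \<in> Rep A B" "(D, thom A B D n) \<in> Rep A B"
    using C D by (auto simp: Rep_eq[OF A B] tcls_def)
  show ?thesis
  proof
    assume "eqv A B (C, thom A B C m) (D, thom A B D n)"
    then obtain E where E: "E \<in> Idx A B" "E \<subseteq> C" "E \<subseteq> D"
      "trans A B C E (thom A B C m) = trans A B D E (thom A B D n)"
      by (auto simp: eqv_def)
    then show "m = n"
      using tr[OF C E(1,2)] tr[OF D E(1,3)] inj[OF E(1)] by simp
  next
    assume "m = n"
    then show "eqv A B (C, thom A B C m) (D, thom A B D n)"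
      using R CD tr[OF C CD] tr[OF D CD] unfolding eqv_def by (intro conjI bexI[of _ "C \<inter> D"]) auto
  qed
qed

lemma cls_thom:
  assumes A: "sandwiched A" and B: "sandwiched B" and C: "C \<in> Idx A B"
  shows "cls A B (C, thom A B C n) = tcls A B n"
proof
  show "cls A B (C, thom A B C n) \<subseteq> tcls A B n"
  proof
    fix q assume "q \<in> cls A B (C, thom A B C n)"
    then have q: "eqv A B q (C, thom A B C n)" by (simp add: cls_def)
    then have "q \<in> Rep A B" by (simp add: eqv_def)
    then obtain D m where D: "D \<in> Idx A B" "q = (D, thom A B D m)"
      by (auto simp: Rep_eq[OF A B] tcls_def)
    then have "m = n" using q eqv_thom[OF A B D(1) C] by simp
    with D show "q \<in> tcls A B n" by (auto simp: tcls_def)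
  qed
  show "tcls A B n \<subseteq> cls A B (C, thom A B C n)"
    using eqv_thom[OF A B _ C] by (auto simp: tcls_def cls_def)
qed

lemma tor_eq:
  assumes A: "sandwiched A" and B: "sandwiched B"
  shows "tor A B = range (tcls A B)"
proof -
  have "tor A B = (\<Union>n. cls A B ` tcls A B n)"
    by (simp add: tor_def Rep_eq[OF A B] image_UN)
  also have "\<dots> = (\<Union>n. {tcls A B n})"
  proof (rule SUP_cong[OF refl])
    fix n
    have "cls A B ` tcls A B n = (\<lambda>C. tcls A B n) ` Idx A B"
      unfolding tcls_def[of A B n] image_image
      by (rule image_cong[OF refl]) (simp add: cls_thom[OF A B] tcls_def)
    then show "cls A B ` tcls A B n = {tcls A B n}"
      using Idx_nonempty[OF A B] by auto
  qed
  finally show ?thesis by (simp add: UNION_singleton_eq_range)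
qed

text \<open>Whichever representative \<open>SOME\<close> selects in \<open>tshift\<close> or
  \<open>tact\<close>, it carries the label \<open>n\<close>.\<close>

lemma some_tcls:
  assumes "sandwiched A" "sandwiched B"
  obtains C where "C \<in> Idx A B" "(SOME p. p \<in> tcls A B n) = (C, thom A B C n)"
proof -
  have "(SOME p. p \<in> tcls A B n) \<in> tcls A B n"
    using Idx_nonempty[OF assms] by (auto simp: some_in_eq tcls_def)
  then show thesis using that by (auto simp: tcls_def)
qed

lemma tcls_inject:
  assumes "sandwiched A" "sandwiched B"
  shows "tcls A B m = tcls A B n \<longleftrightarrow> m = n"
proof
  assume eq: "tcls A B m = tcls A B n"
  have AB: "A \<inter> B \<in> Idx A B" by (rule Idx_nonempty[OF assms])
  then have "(A \<inter> B, thom A B (A \<inter> B) m) \<in> tcls A B n"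
    unfolding eq [symmetric] by (simp add: tcls_def)
  then have "thom A B (A \<inter> B) m = thom A B (A \<inter> B) n"
    by (auto simp: tcls_def)
  then show "m = n"
    using AB thom_inject by (metis Idx_iff[OF assms])
qed simp

lemma tshift_tcls:
  assumes A: "sandwiched A" and B: "sandwiched B"
  shows "tshift A B n (tcls A B m) = tcls A B (m + n)"
proof -
  obtain C where C: "C \<in> Idx A B" "(SOME p. p \<in> tcls A B m) = (C, thom A B C m)"
    by (rule some_tcls[OF A B])
  have AC: "sandwiched_pair A C" using C(1) by (simp add: Idx_iff[OF A B])
  have "(\<lambda>x\<in>Dim A C. dadd (Gr B C) (thom A B C m x) n) = thom A B C (m + n)"
    by (rule thom_eqI[OF AC]) (simp_all add: Dim_eq[OF AC] thom_dimth[OF AC] dadd_dimth add.assoc)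
  then show ?thesis
    using C by (simp add: tshift_def cls_thom[OF A B])
qed

lemma tcomp_tcls:
  assumes A: "sandwiched A" and B: "sandwiched B" and D: "sandwiched D"
  shows "tcomp A B D (tcls A B m) (tcls B D n) = tcls A D (m + n)"
proof -
  let ?P = "\<lambda>q. \<exists>C1 phi1 C2 phi2 C'. (C1, phi1) \<in> tcls A B m \<and> (C2, phi2) \<in> tcls B D n \<and>
     C' \<in> Idx A B \<and> C' \<in> Idx B D \<and> C' \<in> Idx A D \<and> C' \<subseteq> C1 \<inter> C2 \<and>
     q = (C', compose (Dim A C') (trans B D C2 C' phi2) (trans A B C1 C' phi1))"
  \<comment> \<open>A common index for all three torsors: the \<open>SOME\<close> in
    \<open>tcomp\<close> has a candidate, and any candidate then gives label
    \<open>m + n\<close>.\<close>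
  let ?C = "(A \<inter> B) \<inter> (B \<inter> D)"
  have sandwiched: "sandwiched ?C" using A B D by (intro sandwiched_Int)
  have "?P (?C, compose (Dim A ?C) (trans B D (B \<inter> D) ?C (thom B D (B \<inter> D) n))
      (trans A B (A \<inter> B) ?C (thom A B (A \<inter> B) m)))"
    using Idx_nonempty[OF A B] Idx_nonempty[OF B D] sandwiched A B D
    by (intro exI conjI) (auto simp: tcls_def Idx_iff sandwiched_pair_def)
  then have "?P (SOME q. ?P q)" by (rule someI[of ?P])
  then obtain C1 C2 C' where C1: "C1 \<in> Idx A B" and C2: "C2 \<in> Idx B D"
    and C': "C' \<in> Idx A B" "C' \<in> Idx B D" "C' \<in> Idx A D" "C' \<subseteq> C1" "C' \<subseteq> C2"
    and q: "(SOME q. ?P q) = (C', compose (Dim A C') (trans B D C2 C' (thom B D C2 n))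
      (trans A B C1 C' (thom A B C1 m)))"
    by (auto simp: tcls_def)
  have gp: "sandwiched_pair A C'" "sandwiched_pair B C'"
    using C'(1) by (simp_all add: Idx_iff[OF A B])
  have "trans A B C1 C' (thom A B C1 m) = thom A B C' m"
    using C1 C' by (intro trans_thom) (auto simp: Idx_iff A B sandwiched_pair_def)
  moreover have "trans B D C2 C' (thom B D C2 n) = thom B D C' n"
    using C2 C' by (intro trans_thom) (auto simp: Idx_iff D B sandwiched_pair_def)
  moreover have "compose (Dim A C') (thom B D C' n) (thom A B C' m) = thom A D C' (m + n)"
    by (rule thom_eqI[OF gp(1)])
      (auto simp: compose_eq Dim_eq[OF gp(1)] thom_dimth[OF gp(1)] thom_dimth[OF gp(2)] add.assoc)
  ultimately show ?thesis
    unfolding tcomp_def q by (simp add: cls_thom[OF A D C'(3)])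
qed

section \<open>The action of multiplication on dimension theories\<close>

text \<open>Compares two base points of \<open>hA/hC\<close>: the integral one and the image under
  \<open>h\<close>. It vanishes when a nonzero \<open>h\<close> maps \<open>EK\<close> onto
  itself.\<close>

definition mshift :: "'k::field K2 \<Rightarrow> 'k K2 set \<Rightarrow> 'k K2 set \<Rightarrow> int" where
  "mshift h A C = relidx (integral_part (mulset h A) (mulset h C)) (mulset h (integral_part A C))"

lemma sandwiched_mulset:
  assumes h: "h \<noteq> 0" and A: "sandwiched A"
  shows "sandwiched (mulset h A)"
proof -
  obtain n m where nm: "kspace A" "ideal2 m \<subseteq> A" "A \<subseteq> ideal2 n"
    using A by (auto simp: sandwiched_def)
  then have "ideal2 (m + nu2 h) \<subseteq> mulset h A" "mulset h A \<subseteq> ideal2 (n + nu2 h)"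
    by (simp_all add: mulset_subset_iff h flip: mulset_ideal2[OF h])
  then show ?thesis
    using nm(1) kspace_mulset by (auto simp: sandwiched_def)
qed

lemma sandwiched_pair_mulset: "h \<noteq> 0 \<Longrightarrow> sandwiched_pair A C \<Longrightarrow> sandwiched_pair (mulset h A) (mulset h C)"
  by (simp add: sandwiched_pair_def sandwiched_mulset mulset_mono)

text \<open>Ensures that \<open>mshift\<close> is the index of commensurable spaces. The block
  bounds come from \<open>mulset_block\<close> for \<open>h\<close> and for its inverse.\<close>

lemma commens_integral_part_mulset:
  fixes h :: "'k::field K2"
  assumes h: "h \<noteq> 0" and AC: "sandwiched_pair A C"
  shows "commens (mulset h (integral_part A C)) (integral_part (mulset h A) (mulset h C))"
proof -
  note k = sandwiched_pairD(1-3)[OF AC]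
  obtain n m where nm: "ideal2 m \<subseteq> C" "A \<subseteq> ideal2 n"
    using sandwiched_pair_bounds[OF AC] by metis
  let ?n = "n + nu2 h" and ?m = "m + nu2 h"
  let ?T = "ideal2 n \<inter> trunc_lat m 0 :: 'k K2 set"
  have hi: "inverse h \<noteq> 0" using h by simp
  obtain N where N: "\<And>j. mulset h (ideal2 n \<inter> trunc_lat m j) \<subseteq> ideal2 ?n \<inter> trunc_lat ?m (j + N)"
    using mulset_block[OF h] by blast
  obtain N' where "\<And>j. mulset (inverse h) (ideal2 ?n \<inter> trunc_lat ?m j)
      \<subseteq> ideal2 (?n + nu2 (inverse h)) \<inter> trunc_lat (?m + nu2 (inverse h)) (j + N')"
    using mulset_block[OF hi] by blast
  \<comment> \<open>The exponent \<open>- N'\<close> is chosen so that multiplication by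
    \<open>inverse h\<close> lands in exponent 0.\<close>
  from this[of "- N'"] have lower: "ideal2 ?n \<inter> trunc_lat ?m (- N') \<subseteq> mulset h ?T"
    by (intro mulset_subset_via_inverse h) (simp add: nu2_inverse)
  have "integral_part A C = ssum (trunc_lat m 0 \<inter> A) C"
    by (rule integral_part_trunc_lat[OF k(1,2) nm(1) k(3)])
  also have "trunc_lat m 0 \<inter> A = ?T \<inter> A"
    using nm(2) by blast
  finally have "mulset h (integral_part A C) = ssum (mulset h ?T \<inter> mulset h A) (mulset h C)"
    by (simp only: mulset_ssum mulset_Int[OF h])
  moreover have "commens (ssum (mulset h ?T \<inter> mulset h A) (mulset h C)) (integral_part (mulset h A) (mulset h C))"
  proof (rule commens_integral_part[OF _ _ _ _ _ _ lower N])
    show "ideal2 ?m \<subseteq> mulset h C" "mulset h C \<subseteq> mulset h A" "mulset h A \<subseteq> ideal2 ?n"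
      using nm k by (simp_all add: mulset_subset_iff h flip: mulset_ideal2[OF h])
  qed (intro kspace_mulset k kspace_block)+
  ultimately show ?thesis by simp
qed

lemma Gr_mulset:
  assumes h: "h \<noteq> 0" and AC: "sandwiched_pair A C"
  shows "mulset h U \<in> Gr (mulset h A) (mulset h C) \<longleftrightarrow> U \<in> Gr A C"
proof -
  note k = kspace_integral_part[OF sandwiched_pairD(1,2)[OF AC]]
    kspace_integral_part[OF sandwiched_pairD(1,2)[OF sandwiched_pair_mulset[OF h AC]]]
  note c = commens_integral_part_mulset[OF h AC]
  have ks: "kspace (mulset h U) \<longleftrightarrow> kspace U"
    using kspace_mulset[of U h] kspace_mulset[of "mulset h U" "inverse h"] h by auto
  have "commens (mulset h U) (integral_part (mulset h A) (mulset h C)) \<longleftrightarrow> commens (mulset h U) (mulset h (integral_part A C))"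
    if U: "kspace U"
    using commens_trans[OF kspace_mulset[OF U] kspace_mulset[OF k(1)] k(2) _ c]
      commens_trans[OF kspace_mulset[OF U] k(2) kspace_mulset[OF k(1)] _ commens_sym[OF c]] by blast
  then show ?thesis
    using ks by (auto simp: Gr_iff[OF AC] Gr_iff[OF sandwiched_pair_mulset[OF h AC]]
        mulset_subset_iff[OF h] commens_mulset[OF h])
qed

text \<open>Evaluation happens at \<open>hU\<close>, measured from the integral base point of
  \<open>hA/hC\<close>; the cocycle rule moves this to the image of the old base point.\<close>

lemma hact_inverse_dimth:
  assumes h: "h \<noteq> 0" and AC: "sandwiched_pair A C"
  shows "hact (inverse h) (dimth (mulset h A) (mulset h C) n) = dimth A C (n + mshift h A C)"
proof
  fix U
  note hAC = sandwiched_pair_mulset[OF h AC]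
  have "relidx (integral_part (mulset h A) (mulset h C)) (mulset h U) = mshift h A C + relidx (integral_part A C) U"
    if "U \<in> Gr A C"
    using relidx_integral_part_cocycle[OF hAC, of "mulset h (integral_part A C)" "mulset h U"] that integral_part_mem_Gr[OF AC]
    by (simp add: Gr_mulset[OF h AC] relidx_mulset[OF h] mshift_def)
  then show "hact (inverse h) (dimth (mulset h A) (mulset h C) n) U = dimth A C (n + mshift h A C) U"
    by (simp add: hact_def dimth_def Gr_mulset[OF h AC])
qed

lemma hact_dimth:
  assumes h: "h \<noteq> 0" and AC: "sandwiched_pair A C"
  shows "hact h (dimth A C n) = dimth (mulset h A) (mulset h C) (n - mshift h A C)"
proof -
  have "hact h (dimth A C n) =
      hact h (hact (inverse h) (dimth (mulset h A) (mulset h C) (n - mshift h A C)))"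
    by (simp add: hact_inverse_dimth[OF h AC])
  also have "\<dots> = dimth (mulset h A) (mulset h C) (n - mshift h A C)"
    using h by (simp add: hact_def fun_eq_iff)
  finally show ?thesis .
qed

text \<open>Conjugation adds \<open>mshift h A C\<close>, then \<open>n\<close>, then subtracts
  \<open>mshift h B C\<close>. The net shift must be the same for all \<open>C\<close>, because
  \<open>tact\<close> uses an unspecified representative.\<close>

lemma tact_tcls:
  assumes h: "h \<noteq> 0" and A: "sandwiched A" and B: "sandwiched B"
    and s: "\<And>C. C \<in> Idx A B \<Longrightarrow> mshift h A C - mshift h B C = s"
  shows "tact h A B (tcls A B n) = tcls (mulset h A) (mulset h B) (n + s)"
proof -
  obtain C where C: "C \<in> Idx A B" "(SOME p. p \<in> tcls A B n) = (C, thom A B C n)"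
    by (rule some_tcls[OF A B])
  have AC: "sandwiched_pair A C" and BC: "sandwiched_pair B C"
    using C(1) by (simp_all add: Idx_iff[OF A B])
  note hA = sandwiched_mulset[OF h A] and hB = sandwiched_mulset[OF h B]
  note hAC = sandwiched_pair_mulset[OF h AC]
  have hC: "mulset h C \<in> Idx (mulset h A) (mulset h B)"
    by (simp add: Idx_iff[OF hA hB] sandwiched_pair_mulset h AC BC)
  have "(\<lambda>y\<in>Dim (mulset h A) (mulset h C). hact h (thom A B C n (hact (inverse h) y)))
      = thom (mulset h A) (mulset h B) (mulset h C) (n + s)"
    using s[OF C(1)]
    by (intro thom_eqI[OF hAC])
      (auto simp: Dim_eq[OF hAC] hact_inverse_dimth[OF h AC] hact_dimth[OF h BC] thom_dimth[OF AC]
        algebra_simps)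
  then show ?thesis
    using C by (simp add: tact_def cls_thom[OF hA hB hC])
qed

text \<open>Intersecting with \<open>hC\<close> and projecting modulo \<open>hC\<close> send both
  base points of \<open>hA/hD\<close> to the corresponding ones of \<open>hC/hD\<close> and
  \<open>hA/hC\<close>, so \<open>relidx_split\<close> applies.\<close>

lemma mshift_split:
  assumes h: "h \<noteq> 0" and AC: "sandwiched_pair A C" and CD: "sandwiched_pair C D"
  shows "mshift h A D = mshift h A C + mshift h C D"
proof -
  note AD = sandwiched_pair_trans[OF AC CD]
  let ?h = "mulset h"
  note k = sandwiched_pairD(1-3)[OF AC] sandwiched_pairD(2,3)[OF CD]
  note kb = kspace_integral_part[OF kspace_mulset kspace_mulset, OF k(1,4)] kspace_mulset[OF kspace_integral_part, OF k(1,4)]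
  have 1: "integral_part (?h A) (?h D) \<inter> ?h C = integral_part (?h C) (?h D)"
    "ssum (integral_part (?h A) (?h D)) (?h C) = integral_part (?h A) (?h C)"
    by (intro integral_part_Int integral_part_ssum kspace_mulset mulset_mono k)+
  have 2: "?h (integral_part A D) \<inter> ?h C = ?h (integral_part C D)" "ssum (?h (integral_part A D)) (?h C) = ?h (integral_part A C)"
    using integral_part_Int[OF k(2,5,3)] integral_part_ssum[OF k(2,4,5), of A]
    by (simp_all flip: mulset_ssum mulset_Int[OF h])
  from relidx_split[OF kb(1) kb(2) kspace_mulset[OF k(2), of h] commens_sym[OF commens_integral_part_mulset[OF h AD]]]
  show ?thesis
    unfolding mshift_def 1 2 by simp
qed

section \<open>The index of multiplication on graded pieces\<close>

lemma kspan_empty: "kspan {} = {0}"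
  by (simp add: kspan_eq_span)

text \<open>\<open>mon i j\<close> spans the quotient by \<open>block_step\<close> and does not lie
  in the smaller block.\<close>

lemma qdim_lead_step:
  "qdim (ideal2 i \<inter> trunc_lat (i + 1) j) (ideal2 i \<inter> trunc_lat (i + 1) (j + 1) :: 'k::field K2 set) = 1"
    (is "qdim ?X ?Y = 1")
proof -
  have S: "(\<lambda>i. mon i j :: 'k K2) ` {i..<i + 1} = {mon i j}"
    by (auto simp: image_iff)
  have "qdim ?X ?Y \<le> 1"
    using qdim_le[of "{mon i j}" ?X ?Y] block_step[of i "i + 1" j, where 'a = 'k] mon_block[of i i j "i + 1"]
    unfolding S by simp
  moreover have "qdim ?X ?Y \<noteq> 0"
  proof
    assume 0: "qdim ?X ?Y = 0"
    have "qfin ?X ?Y" by (rule qfin_block) simp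
    then obtain S :: "'k K2 set" where "finite S" "card S = qdim ?X ?Y" "?X \<subseteq> ssum ?Y (kspan S)"
      by (rule qdim_witness)
    then have "?X \<subseteq> ssum ?Y (kspan {})" using 0 by simp
    then have "?X \<subseteq> ?Y" by (auto simp: kspan_empty ssum_def)
    then have "(mon i j :: 'k K2) \<in> trunc_lat (i + 1) (j + 1)"
      using mon_block[of i i j "i + 1"] by blast
    then have "(mon i j :: 'k K2) $$ i $$ j = 0"
      by (simp add: trunc_lat_def)
    then show False
      by (simp add: mon_nth)
  qed
  ultimately show ?thesis by linarith
qed

lemma relidx_lead:
  fixes i j :: int
  defines "F \<equiv> \<lambda>j. ideal2 i \<inter> trunc_lat (i + 1) j :: 'k::field K2 set"
  shows "relidx (F 0) (F j) = - j"
proof -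
  have comm: "commens (F a) (F b)" if "a \<le> b" for a b
    unfolding F_def using that trunc_lat_mono[OF that] by (intro commens_if_qfin qfin_block) auto
  have k: "kspace (F a)" for a
    unfolding F_def by (rule kspace_block)
  have step: "relidx (F a) (F (a + 1)) = - 1" for a
  proof -
    have "F a \<inter> F (a + 1) = F (a + 1)"
      using trunc_lat_mono[of a "a + 1" "i + 1"] by (auto simp: F_def)
    then show ?thesis
      using qdim_lead_step[of i a, where 'k = 'k] by (simp add: relidx_def qdim_refl F_def)
  qed
  have nat: "relidx (F a) (F (a + int n)) = - int n" for a n
  proof (induction n)
    case 0
    then show ?case by (simp add: relidx_refl)
  next
    case (Suc n)
    have "relidx (F a) (F (a + int n + 1)) = relidx (F a) (F (a + int n)) + relidx (F (a + int n)) (F (a + int n + 1))"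
      by (rule relidx_cocycle[OF k k k comm comm]) auto
    then show ?case
      using Suc step[of "a + int n"] by (simp add: algebra_simps)
  qed
  show ?thesis
  proof (cases "0 \<le> j")
    case True
    then show ?thesis using nat[of 0 "nat j"] by simp
  next
    case False
    then show ?thesis using nat[of j "nat (- j)"] relidx_swap[of "F 0" "F j"] by simp
  qed
qed

lemma integral_part_ideal2:
  "integral_part (ideal2 i) (ideal2 (i + 1)) = ideal2 i \<inter> trunc_lat (i + 1) 0"
proof -
  have "integral_part (ideal2 i) (ideal2 (i + 1)) = ssum (trunc_lat (i + 1) 0 \<inter> ideal2 i) (ideal2 (i + 1))"
    by (rule integral_part_trunc_lat) (simp_all add: kspace_ideal2 ideal2_mono)
  also have "\<dots> = trunc_lat (i + 1) 0 \<inter> ideal2 i"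
    using ideal2_trunc_lat[of "i + 1" 0] ideal2_mono[of i "i + 1"]
    by (intro ssum_absorb kspace_Int kspace_trunc_lat kspace_ideal2) auto
  finally show ?thesis by (simp add: Int_commute)
qed

lemma nu1_inverse:
  fixes h :: "'k::field K2"
  assumes "h \<noteq> 0"
  shows "nu1 (inverse h) = - nu1 h"
proof -
  have "h $$ fls_subdegree h * inverse h $$ (- fls_subdegree h) = (h * inverse h) $$ 0"
    using fls_mult_vanish(2)[of "fls_subdegree h" h "- fls_subdegree h" "inverse h"] by simp
  then have 1: "h $$ fls_subdegree h * inverse h $$ (- fls_subdegree h) = 1"
    using assms by simp
  then have "inverse h $$ (- fls_subdegree h) = inverse (h $$ fls_subdegree h)"
    by (metis inverse_unique)
  then show ?thesis
    by (simp add: nu1_def)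
qed

text \<open>On the graded piece, \<open>h\<close> acts through its leading coefficient, of
  \<open>t1\<close>-order \<open>nu1 h\<close>. The reverse inclusion is the forward one for
  \<open>inverse h\<close>.\<close>

lemma mulset_lead:
  fixes h :: "'k::field K2"
  assumes h: "h \<noteq> 0"
  shows "mulset h (ideal2 i \<inter> trunc_lat (i + 1) j)
    = ideal2 (i + nu2 h) \<inter> trunc_lat (i + nu2 h + 1) (j + nu1 h)"
proof -
  \<comment> \<open>Within \<open>ideal2 i\<close>, truncation below \<open>i + 1\<close> restricts
    the single coefficient of \<open>t2^i\<close>.\<close>
  have lead: "x \<in> ideal2 i \<inter> trunc_lat (i + 1) j \<longleftrightarrow> x \<in> ideal2 i \<and> (\<forall>l<j. x $$ i $$ l = 0)"
    for x :: "'k K2" and i j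
    by (auto simp: ideal2_def trunc_lat_def order_le_less)
  have le: "mulset g (ideal2 i \<inter> trunc_lat (i + 1) j)
      \<subseteq> ideal2 (i + nu2 g) \<inter> trunc_lat (i + nu2 g + 1) (j + nu1 g)" for g :: "'k K2" and i j
  proof
    fix y assume "y \<in> mulset g (ideal2 i \<inter> trunc_lat (i + 1) j)"
    then obtain x where "y = g * x" "x \<in> ideal2 i \<inter> trunc_lat (i + 1) j"
      by (auto simp: mulset_def)
    then have x: "y = g * x" "x \<in> ideal2 i" "\<forall>l<j. x $$ i $$ l = 0"
      using lead by blast+
    have g: "g \<in> ideal2 (nu2 g)"
      by (rule subdegree_ideal2) (simp add: nu2_def)
    have y: "y \<in> ideal2 (nu2 g + i)" "y $$ (nu2 g + i) = g $$ nu2 g * x $$ i"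
      using mult_ideal2[OF g x(2)] fls_mult_vanish(2)[of "nu2 g" g i x] g x by (auto simp: ideal2_def)
    have "y $$ (nu2 g + i) $$ l = 0" if "l < j + nu1 g" for l
      unfolding y(2) by (rule fls_mult_vanish(1)[of "nu1 g" _ j])
        (use x(3) that in \<open>auto simp: nu1_def nu2_def\<close>)
    then show "y \<in> ideal2 (i + nu2 g) \<inter> trunc_lat (i + nu2 g + 1) (j + nu1 g)"
      unfolding lead using y(1) by (simp add: add.commute)
  qed
  have "ideal2 (i + nu2 h) \<inter> trunc_lat (i + nu2 h + 1) (j + nu1 h)
      \<subseteq> mulset h (ideal2 i \<inter> trunc_lat (i + 1) j)"
    using le[of "inverse h" "i + nu2 h" "j + nu1 h"]
    by (intro mulset_subset_via_inverse h) (simp add: nu2_inverse nu1_inverse h)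
  with le show ?thesis by blast
qed

lemma mshift_lead:
  assumes h: "h \<noteq> (0 :: 'k::field K2)"
  shows "mshift h (ideal2 i) (ideal2 (i + 1)) = - nu1 h"
proof -
  have "mulset h (integral_part (ideal2 i) (ideal2 (i + 1)))
      = ideal2 (i + nu2 h) \<inter> trunc_lat (i + nu2 h + 1) (nu1 h)"
    using mulset_lead[OF h, of i 0] by (simp add: integral_part_ideal2)
  moreover have "integral_part (mulset h (ideal2 i)) (mulset h (ideal2 (i + 1)))
      = ideal2 (i + nu2 h) \<inter> trunc_lat (i + nu2 h + 1) 0"
    using integral_part_ideal2[of "i + nu2 h"] by (simp add: mulset_ideal2[OF h] add.commute add.left_commute)
  ultimately show ?thesis
    by (simp add: mshift_def relidx_lead)
qed

lemma sandwiched_pair_ideal2: "n \<le> m \<Longrightarrow> sandwiched_pair (ideal2 n) (ideal2 m)"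
  by (simp add: sandwiched_pair_def sandwiched_ideal2 ideal2_mono)

lemma mshift_ideal2:
  assumes h: "h \<noteq> (0 :: 'k::field K2)" and "a \<le> m"
  shows "mshift h (ideal2 a) (ideal2 m) = - (m - a) * nu1 h"
  using assms(2)
proof (induction m rule: int_ge_induct)
  case base
  show ?case
    by (simp add: mshift_def integral_part_refl kspace_ideal2 kspace_mulset relidx_refl)
next
  case (step m)
  have "mshift h (ideal2 a) (ideal2 (m + 1))
      = mshift h (ideal2 a) (ideal2 m) + mshift h (ideal2 m) (ideal2 (m + 1))"
    using step.hyps by (intro mshift_split[OF h] sandwiched_pair_ideal2) auto
  then show ?case
    using step.IH mshift_lead[OF h, of m] by (simp add: algebra_simps)
qed

text \<open>Both terms are completed by the same \<open>mshift h C (ideal2 m)\<close>, which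
  cancels; so the difference is independent of \<open>C\<close>, as \<open>tact_tcls\<close>
  requires.\<close>

lemma mshift_diff:
  assumes h: "h \<noteq> (0 :: 'k::field K2)" and C: "C \<in> Idx (ideal2 a) (ideal2 b)"
  shows "mshift h (ideal2 a) C - mshift h (ideal2 b) C = (a - b) * nu1 h"
proof -
  have AC: "sandwiched_pair (ideal2 a) C" and BC: "sandwiched_pair (ideal2 b) C"
    using C by (simp_all add: Idx_iff sandwiched_ideal2)
  obtain m where m: "ideal2 m \<subseteq> C"
    using sandwiched_pairD(6)[OF AC] by blast
  have Cm: "sandwiched_pair C (ideal2 m)"
    using AC m by (simp add: sandwiched_pair_def sandwiched_ideal2)
  have "a \<le> m" "b \<le> m"
    using m sandwiched_pairD(3)[OF AC] sandwiched_pairD(3)[OF BC] ideal2_subset_iff by blast+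
  then have "mshift h (ideal2 a) C + mshift h C (ideal2 m) = - (m - a) * nu1 h"
    "mshift h (ideal2 b) C + mshift h C (ideal2 m) = - (m - b) * nu1 h"
    using mshift_split[OF h AC Cm] mshift_split[OF h BC Cm] mshift_ideal2[OF h] by simp_all
  then show ?thesis by (simp add: algebra_simps)
qed

section \<open>The commutator pairing\<close>

lemma GVL_OK:
  assumes "F \<in> GVL OK"
  obtains k where "F = (fst F, tcls OK (mulset (fst F) OK) k)" "fst F \<noteq> 0"
proof -
  obtain h d where F: "F = (h, d)" "h \<noteq> 0" "d \<in> tor OK (mulset h OK)"
    using assms by (auto simp: GVL_def)
  then obtain k where "d = tcls OK (mulset h OK) k"
    using tor_eq[OF sandwiched_ideal2 sandwiched_mulset[OF _ sandwiched_ideal2], of h 0 0] by (auto simp: OK_ideal2)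
  with F show thesis using that by simp
qed

text \<open>The correction is \<open>mshift_diff\<close> for the exponents 0 of \<open>OK\<close>
  and \<open>nu2 g\<close> of \<open>g OK\<close>, with \<open>f\<close> acting.\<close>

lemma gmul_OK:
  fixes f g :: "'k::field K2"
  assumes f: "f \<noteq> 0" and g: "g \<noteq> 0"
  shows "snd (gmul OK (f, tcls OK (mulset f OK) j) (g, tcls OK (mulset g OK) k))
    = tcls OK (mulset (f * g) OK) (j + k - nu2 g * nu1 f)"
proof -
  have gL: "mulset g OK = ideal2 (nu2 g)"
    by (simp add: OK_ideal2 mulset_ideal2[OF g])
  have sandwiched: "sandwiched OK" "sandwiched (mulset f OK)" "sandwiched (mulset f (mulset g OK))"
    using f g by (simp_all add: OK_ideal2 sandwiched_ideal2 sandwiched_mulset)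
  have "tact f OK (mulset g OK) (tcls OK (mulset g OK) k)
      = tcls (mulset f OK) (mulset f (mulset g OK)) (k - nu2 g * nu1 f)"
    unfolding gL unfolding OK_ideal2
    using tact_tcls[OF f sandwiched_ideal2 sandwiched_ideal2, of 0 "nu2 g" "- nu2 g * nu1 f" k]
      mshift_diff[OF f, of _ 0 "nu2 g"] by simp
  then have "snd (gmul OK (f, tcls OK (mulset f OK) j) (g, tcls OK (mulset g OK) k))
      = tcls OK (mulset f (mulset g OK)) (j + (k - nu2 g * nu1 f))"
    by (simp add: gmul_def tcomp_tcls[OF sandwiched])
  then show ?thesis by (simp add: mulset_mulset add_diff_eq)
qed

theorem theorem1:
  fixes f g :: "'k::field fls fls"
  assumes "f \<noteq> 0" and "g \<noteq> 0"
  shows "psiV OK f g = - nuK f g"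
proof -
  note goodOK = sandwiched_ideal2[of 0, folded OK_ideal2]
  have sandwiched: "sandwiched (mulset h (OK :: 'k K2 set))" if "h \<noteq> 0" for h
    by (rule sandwiched_mulset[OF that goodOK])
  have fg: "f * g \<noteq> 0" using assms by simp
  \<comment> \<open>The labels of the two lifts enter both products through their sum and cancel, so
    every pair of lifts determines the same \<open>n\<close>.\<close>
  have eq: "snd (gmul OK F G) = tshift OK (mulset (f * g) OK) n (snd (gmul OK G F))
      \<longleftrightarrow> n = - nuK f g"
    if F: "F \<in> GVL OK" "fst F = f" and G: "G \<in> GVL OK" "fst G = g" for F G n
  proof -
    obtain j where j: "F = (f, tcls OK (mulset f OK) j)"
      using GVL_OK[OF F(1)] F(2) by metis
    obtain k where k: "G = (g, tcls OK (mulset g OK) k)"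
      using GVL_OK[OF G(1)] G(2) by metis
    have "snd (gmul OK F G) = tcls OK (mulset (f * g) OK) (j + k - nu2 g * nu1 f)"
      unfolding j k by (rule gmul_OK[OF assms])
    moreover have "snd (gmul OK G F) = tcls OK (mulset (f * g) OK) (k + j - nu2 f * nu1 g)"
      unfolding j k using gmul_OK[OF assms(2,1)] by (simp add: mult.commute)
    ultimately show ?thesis
      by (auto simp: tshift_tcls[OF goodOK sandwiched[OF fg]] tcls_inject[OF goodOK sandwiched[OF fg]]
          nuK_def algebra_simps)
  qed
  \<comment> \<open>Uniqueness in \<open>THE\<close> needs actual lifts, since otherwise every
    \<open>n\<close> would satisfy the implication vacuously.\<close>
  have lift: "(h, tcls OK (mulset h OK) 0) \<in> GVL OK" if "h \<noteq> 0" for h :: "'k K2"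
    using that tor_eq[OF goodOK sandwiched[OF that]] by (simp add: GVL_def)
  show ?thesis
    unfolding psiV_def
  proof (rule the_equality)
    show "\<forall>F G. F \<in> GVL OK \<and> fst F = f \<and> G \<in> GVL OK \<and> fst G = g \<longrightarrow>
        snd (gmul OK F G) = tshift OK (mulset (f * g) OK) (- nuK f g) (snd (gmul OK G F))"
      using eq by blast
    fix n
    assume "\<forall>F G. F \<in> GVL OK \<and> fst F = f \<and> G \<in> GVL OK \<and> fst G = g \<longrightarrow>
        snd (gmul OK F G) = tshift OK (mulset (f * g) OK) n (snd (gmul OK G F))"
    then show "n = - nuK f g"
      using eq[OF lift _ lift] assms lift by fastforce
  qed
qed

end
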